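(* Let $\mathcal R_0$ be the hyperfinite ergodic p.m.p. equivalence relation on a standard probability space $(X,\mu)$, and let $\mathcal S\in\mathrm{Sub}(\mathcal R_0)$ be a subequivalence relation. The following are equivalent: (i) $\mathcal S$ is aperiodic and has everywhere infinite index in $\mathcal R_0$; (ii) the $[\mathcal R_0]$-orbit of $\mathcal S$ is dense in $\mathrm{Sub}(\mathcal R_0)$; (iii) the $\mathrm{Aut}(\mathcal R_0)$-orbit of $\mathcal S$ is dense in $\mathrm{Sub}(\mathcal R_0)$.
   Context: Standard probability spaces are atomless. A p.m.p. equivalence relation $\mathcal R$ on $(X,\mu)$ is the orbit equivalence relation of a measure-preserving Borel action of a countable group on $(X,\mu)$. It is ergodic if every $\mathcal R$-invariant Borel set is null or conull, and hyperfinite if on a conull set it is an increasing union of Borel equivalence relations with finite classes; up to isomorphism there is a unique ergodic hyperfinite p.m.p. equivalence relation, denoted $\mathcal R_0$. Everything is considered up to null sets. Equip $\mathcal R$ with the measure $M(A)=\int_X|A_x|\,d\mu(x)$, where $A_x=\{y:(x,y)\in A\}$; $\mathrm{MAlg}(\mathcal R,M)$ is the space of Borel subsets of $\mathcal R$ modulo $M$-null sets with the topology of the metric $d_m(A,B)=m(A\triangle B)$, for $m$ any finite measure equivalent to $M$ (the topology does not depend on $m$). $\mathrm{Sub}(\mathcal R)\subseteq\mathrm{MAlg}(\mathcal R,M)$ is the subspace of (classes of) Borel equivalence relations on $X$ contained in $\mathcal R$. $\mathrm{Aut}(\mathcal R)$ is the group of all measure-preserving automorphisms $T$ of $(X,\mu)$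 (mod null sets) such that $(T\times T)(\mathcal R)=\mathcal R$ up to null sets, and the full group $[\mathcal R]\leq \mathrm{Aut}(\mathcal R)$ consists of those $T$ with $(x,T(x))\in\mathcal R$ for almost every $x$. These act on $\mathrm{Sub}(\mathcal R)$ by $T\cdot\mathcal S=(T\times T)(\mathcal S)$. $\mathcal S$ is aperiodic if almost all its classes are infinite. $\mathcal S$ has everywhere infinite index in $\mathcal R$ if for every Borel $A\subseteq X$ with $\mu(A)>0$, for almost every $x\in A$ the $\mathcal R_{\restriction A}$-class of $x$ contains infinitely many distinct $\mathcal S_{\restriction A}$-classes, where $\mathcal R_{\restriction A}=\mathcal R\cap(A\times A)$. *)

theory Defs
  imports "HOL-Probability.Probability" "HOL-Algebra.Group_Action"
begin

text \<open>A standard Borel space is a type of class \<open>polish_space\<close> with its Borel sets.  On such a space,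
  atomless means that points are null.\<close>

definition standard_prob_space :: "'a::polish_space measure \<Rightarrow> bool" where
  "standard_prob_space \<mu> \<longleftrightarrow> prob_space \<mu> \<and> sets \<mu> = sets borel \<and> (\<forall>x. emeasure \<mu> {x} = 0)"

definition meas_pres :: "'a measure \<Rightarrow> ('a \<Rightarrow> 'a) \<Rightarrow> bool" where
  "meas_pres \<mu> T \<longleftrightarrow> T \<in> \<mu> \<rightarrow>\<^sub>M \<mu> \<and> distr \<mu> \<mu> T = \<mu>"

text \<open>Every countable group is isomorphic to one whose carrier is a set of natural numbers.\<close>

definition pmp_rel :: "'a measure \<Rightarrow> 'a rel \<Rightarrow> bool" where
  "pmp_rel \<mu> R \<longleftrightarrow> (\<exists>(G :: nat monoid) \<phi>. group_action G (space \<mu>) \<phi> \<and>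
     (\<forall>g\<in>carrier G. meas_pres \<mu> (\<phi> g)) \<and>
     R = {(x, y). x \<in> space \<mu> \<and> y \<in> orbit G \<phi> x})"

definition ergodic_rel :: "'a measure \<Rightarrow> 'a rel \<Rightarrow> bool" where
  "ergodic_rel \<mu> R \<longleftrightarrow>
     (\<forall>A\<in>sets \<mu>. R `` A = A \<longrightarrow> A \<in> null_sets \<mu> \<or> space \<mu> - A \<in> null_sets \<mu>)"

definition hyperfinite_rel :: "'a measure \<Rightarrow> 'a rel \<Rightarrow> bool" where
  "hyperfinite_rel \<mu> R \<longleftrightarrow> (\<exists>X\<^sub>0\<in>sets \<mu>. space \<mu> - X\<^sub>0 \<in> null_sets \<mu> \<and>
     (\<exists>F :: nat \<Rightarrow> 'a rel. incseq F \<and> (\<Union>n. F n) = R \<inter> (X\<^sub>0 \<times> X\<^sub>0) \<and>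
       (\<forall>n. F n \<in> sets (\<mu> \<Otimes>\<^sub>M \<mu>) \<and> equiv X\<^sub>0 (F n) \<and> (\<forall>x\<in>X\<^sub>0. finite (F n `` {x})))))"

definition ae_rel :: "'b measure \<Rightarrow> 'b set rel" where
  "ae_rel M = {(A, B). A \<in> sets M \<and> B \<in> sets M \<and> sym_diff A B \<in> null_sets M}"

definition MAlg :: "'b measure \<Rightarrow> 'b set set set" where
  "MAlg M = sets M // ae_rel M"

definition MAlg_class :: "'b measure \<Rightarrow> 'b set \<Rightarrow> 'b set set" where
  "MAlg_class M A = ae_rel M `` {A}"

definition finite_equiv_measure :: "'b measure \<Rightarrow> 'b measure \<Rightarrow> bool" where
  "finite_equiv_measure m M \<longleftrightarrow> finite_measure m \<and> sets m = sets M \<and> null_sets m = null_sets M"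

text \<open>The choice of representatives does not affect the value: see \<open>MAlg_dist_class\<close> below.\<close>

definition MAlg_dist :: "'b measure \<Rightarrow> 'b set set \<Rightarrow> 'b set set \<Rightarrow> real" where
  "MAlg_dist m a b = (let A = (SOME A. A \<in> a); B = (SOME B. B \<in> b)
     in measure m (sym_diff A B))"

definition MAlg_topology :: "'b measure \<Rightarrow> 'b measure \<Rightarrow> 'b set set topology" where
  "MAlg_topology M m = Metric_space.mtopology (MAlg M) (MAlg_dist m)"

text \<open>The measure \<open>M\<close> on \<open>R\<close>.  \<open>emeasure_rel_measure\<close> below shows that the set function is indeed
  countably additive, so that \<open>measure_of\<close> does not degenerate.\<close>

definition rel_measure :: "'a measure \<Rightarrow> 'a rel \<Rightarrow> ('a \<times> 'a) measure" where
  "rel_measure \<mu> R = measure_of R {A \<in> sets (\<mu> \<Otimes>\<^sub>M \<mu>). A \<subseteq> R}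
     (\<lambda>A. \<integral>\<^sup>+x. emeasure (count_space UNIV) (A `` {x}) \<partial>\<mu>)"

definition subrel :: "'a measure \<Rightarrow> 'a rel \<Rightarrow> 'a rel \<Rightarrow> bool" where
  "subrel \<mu> R S \<longleftrightarrow> S \<in> sets (\<mu> \<Otimes>\<^sub>M \<mu>) \<and> equiv (space \<mu>) S \<and> S \<subseteq> R"

definition Sub :: "'a measure \<Rightarrow> 'a rel \<Rightarrow> ('a \<times> 'a) set set set" where
  "Sub \<mu> R = MAlg_class (rel_measure \<mu> R) ` {S. subrel \<mu> R S}"

definition Sub_topology ::
    "'a measure \<Rightarrow> 'a rel \<Rightarrow> ('a \<times> 'a) measure \<Rightarrow> ('a \<times> 'a) set set topology" where
  "Sub_topology \<mu> R m = subtopology (MAlg_topology (rel_measure \<mu> R) m) (Sub \<mu> R)"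

text \<open>Automorphisms modulo null sets are given by representatives.  As an atomless standard
  probability space contains uncountable null Borel sets, every class has a representative that is a
  Borel automorphism of the whole space.\<close>

definition meas_aut :: "'a measure \<Rightarrow> ('a \<Rightarrow> 'a) set" where
  "meas_aut \<mu> = {T. bij_betw T (space \<mu>) (space \<mu>) \<and> meas_pres \<mu> T \<and>
     the_inv_into (space \<mu>) T \<in> \<mu> \<rightarrow>\<^sub>M \<mu>}"

text \<open>\<open>(T \<times> T)(R) = R\<close> up to null sets: the symmetric difference is \<open>M\<close>-null, that is, almost all of
  its sections are empty.\<close>

definition Aut_rel :: "'a measure \<Rightarrow> 'a rel \<Rightarrow> ('a \<Rightarrow> 'a) set" where
  "Aut_rel \<mu> R = {T \<in> meas_aut \<mu>. AE x in \<mu>. (map_prod T T ` R) `` {x} = R `` {x}}"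

definition full_group :: "'a measure \<Rightarrow> 'a rel \<Rightarrow> ('a \<Rightarrow> 'a) set" where
  "full_group \<mu> R = {T \<in> Aut_rel \<mu> R. AE x in \<mu>. (x, T x) \<in> R}"

text \<open>For \<open>T\<close> in \<open>Aut_rel\<close>, \<open>(T \<times> T)(S)\<close> is contained in \<open>R\<close> only up to a null set, so its class in
  \<open>MAlg(R, M)\<close> is that of its intersection with \<open>R\<close>, which is again an equivalence relation.\<close>

definition rel_orbit ::
    "'a measure \<Rightarrow> 'a rel \<Rightarrow> ('a \<Rightarrow> 'a) set \<Rightarrow> 'a rel \<Rightarrow> ('a \<times> 'a) set set set" where
  "rel_orbit \<mu> R \<Gamma> S = (\<lambda>T. MAlg_class (rel_measure \<mu> R) (map_prod T T ` S \<inter> R)) ` \<Gamma>"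

definition aperiodic_rel :: "'a measure \<Rightarrow> 'a rel \<Rightarrow> bool" where
  "aperiodic_rel \<mu> S \<longleftrightarrow> (AE x in \<mu>. infinite (S `` {x}))"

definition restr_rel :: "'a rel \<Rightarrow> 'a set \<Rightarrow> 'a rel" where
  "restr_rel R A = R \<inter> (A \<times> A)"

definition everywhere_infinite_index :: "'a measure \<Rightarrow> 'a rel \<Rightarrow> 'a rel \<Rightarrow> bool" where
  "everywhere_infinite_index \<mu> S R \<longleftrightarrow> (\<forall>A\<in>sets \<mu>. emeasure \<mu> A > 0 \<longrightarrow>
     (AE x in \<mu>. x \<in> A \<longrightarrow> infinite ((restr_rel R A `` {x}) // restr_rel S A)))"

lemma ae_rel_equiv: "equiv (sets M) (ae_rel M)"
proof (rule equivI)
  show "ae_rel M \<subseteq> sets M \<times> sets M" by (auto simp: ae_rel_def)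
  show "refl_on (sets M) (ae_rel M)" by (auto simp: ae_rel_def refl_on_def)
  show "sym (ae_rel M)" by (auto simp: ae_rel_def sym_def Un_commute)
  show "trans (ae_rel M)"
  proof (rule transI)
    fix A B C assume h: "(A, B) \<in> ae_rel M" "(B, C) \<in> ae_rel M"
    then have *: "sym_diff A B \<union> sym_diff B C \<in> null_sets M"
      by (auto simp only: ae_rel_def mem_Collect_eq split_conv intro!: null_sets.Un)
    have "sym_diff A C \<in> null_sets M"
      by (rule null_sets_subset[OF *]) (use h in \<open>auto simp: ae_rel_def\<close>)
    with h show "(A, C) \<in> ae_rel M" by (auto simp: ae_rel_def)
  qed
qed

lemma MAlg_dist_class:
  assumes m: "finite_equiv_measure m M" and A: "A \<in> sets M" and B: "B \<in> sets M"
  shows "MAlg_dist m (MAlg_class M A) (MAlg_class M B) = measure m (sym_diff A B)"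
proof -
  have [simp]: "sets m = sets M" "null_sets m = null_sets M"
    using m by (auto simp: finite_equiv_measure_def)
  define A' where "A' = (SOME A'. A' \<in> MAlg_class M A)"
  define B' where "B' = (SOME B'. B' \<in> MAlg_class M B)"
  have "A \<in> MAlg_class M A" "B \<in> MAlg_class M B"
    using A B by (auto simp: MAlg_class_def ae_rel_def)
  then have A': "(A, A') \<in> ae_rel M" and B': "(B, B') \<in> ae_rel M"
    unfolding A'_def B'_def by (metis Image_singleton_iff MAlg_class_def someI_ex)+
  have "measure m (sym_diff A' B') = measure m (sym_diff A B)"
  proof (rule measure_eq_AE)
    have "AE x in m. x \<notin> sym_diff A A'" "AE x in m. x \<notin> sym_diff B B'"
      using A' B' by (auto simp only: ae_rel_def mem_Collect_eq split_conv intro!: AE_not_in) auto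
    then show "AE x in m. (x \<in> A' - B' \<union> (B' - A')) = (x \<in> A - B \<union> (B - A))"
      by eventually_elim blast
  qed (use A' B' in \<open>auto simp: ae_rel_def\<close>)
  then show ?thesis by (simp add: MAlg_dist_def Let_def A'_def B'_def)
qed

lemma MAlg_metric:
  assumes m: "finite_equiv_measure m M"
  shows "Metric_space (MAlg M) (MAlg_dist m)"
proof
  have [simp]: "sets m = sets M" "null_sets m = null_sets M"
    using m by (auto simp: finite_equiv_measure_def)
  interpret finite_measure m using m by (simp add: finite_equiv_measure_def)
  have rep: "\<exists>A\<in>sets M. x = MAlg_class M A" if "x \<in> MAlg M" for x
    using that by (auto simp: MAlg_def MAlg_class_def quotient_def)
  show "0 \<le> MAlg_dist m x y" for x y by (simp add: MAlg_dist_def Let_def)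
  show "MAlg_dist m x y = MAlg_dist m y x" for x y by (simp add: MAlg_dist_def Let_def Un_commute)
  show "MAlg_dist m x y = 0 \<longleftrightarrow> x = y" if "x \<in> MAlg M" "y \<in> MAlg M" for x y
  proof -
    from rep that obtain A B where AB: "A \<in> sets M" "B \<in> sets M"
      "x = MAlg_class M A" "y = MAlg_class M B" by metis
    have "MAlg_dist m x y = 0 \<longleftrightarrow> sym_diff A B \<in> null_sets m"
      using AB by (simp add: MAlg_dist_class[OF m] measure_eq_emeasure_eq_ennreal null_sets_def
          emeasure_eq_measure)
    also have "\<dots> \<longleftrightarrow> (A, B) \<in> ae_rel M" using AB by (simp add: ae_rel_def)
    also have "\<dots> \<longleftrightarrow> x = y"
      using AB eq_equiv_class_iff[OF ae_rel_equiv, of A M B] by (simp add: MAlg_class_def)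
    finally show ?thesis .
  qed
  show "MAlg_dist m x z \<le> MAlg_dist m x y + MAlg_dist m y z"
    if "x \<in> MAlg M" "y \<in> MAlg M" "z \<in> MAlg M" for x y z
  proof -
    from rep that obtain A B C where AB: "A \<in> sets M" "B \<in> sets M" "C \<in> sets M"
      "x = MAlg_class M A" "y = MAlg_class M B" "z = MAlg_class M C" by metis
    have "measure m (sym_diff A C) \<le>
        measure m (sym_diff A B \<union> sym_diff B C)"
      by (rule finite_measure_mono) (use AB in auto)
    also have "\<dots> \<le> measure m (sym_diff A B) + measure m (sym_diff B C)"
      by (rule measure_Un_le) (use AB in auto)
    finally show ?thesis using AB by (simp add: MAlg_dist_class[OF m])
  qed
qed

lemma pmp_rel_graphs:
  assumes "pmp_rel \<mu> R" "space \<mu> = UNIV"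
  obtains f :: "nat \<Rightarrow> 'a \<Rightarrow> 'a"
  where "\<And>n. meas_pres \<mu> (f n)" "\<And>n. bij (f n)" "R = {(x, y). \<exists>n. y = f n x}"
proof -
  from assms obtain G :: "nat monoid" and \<phi> where *: "group_action G UNIV \<phi>"
      "\<forall>g\<in>carrier G. meas_pres \<mu> (\<phi> g)" "R = {(x, y). y \<in> orbit G \<phi> x}"
    by (auto simp: pmp_rel_def)
  interpret group_action G UNIV \<phi> by fact
  interpret group_hom G "BijGroup UNIV" \<phi> by (rule group_hom)
  have ne: "carrier G \<noteq> {}" by auto
  have mem: "from_nat_into (carrier G) n \<in> carrier G" for n by (rule from_nat_into[OF ne])
  have "\<exists>n. g = from_nat_into (carrier G) n" if "g \<in> carrier G" for g
    using that from_nat_into_surj[of "carrier G" g] by auto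
  then have "R = {(x, y). \<exists>n. y = \<phi> (from_nat_into (carrier G) n) x}"
    unfolding *(3) orbit_def using mem by auto
  moreover have "bij (\<phi> (from_nat_into (carrier G) n))" for n
    using bij_prop0[OF mem] by (simp add: Bij_def)
  ultimately show ?thesis using *(2) mem by (intro that[of "\<lambda>n. \<phi> (from_nat_into (carrier G) n)"]) auto
qed

context
  fixes \<mu> :: "'a::polish_space measure" and R :: "'a rel"
  assumes std: "standard_prob_space \<mu>" and R: "pmp_rel \<mu> R"
begin

lemma std_space [simp]: "space \<mu> = UNIV"
  using std sets_eq_imp_space_eq[of \<mu> borel] by (simp add: standard_prob_space_def)

lemma pmp_rel_disjoint_graphs:
  obtains D :: "nat \<Rightarrow> 'a rel" and f :: "nat \<Rightarrow> 'a \<Rightarrow> 'a"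
  where "\<And>n. D n \<in> sets (\<mu> \<Otimes>\<^sub>M \<mu>)" "disjoint_family D" "R = (\<Union>n. D n)"
    "\<And>n. f n \<in> \<mu> \<rightarrow>\<^sub>M \<mu>" "\<And>n x y. (x, y) \<in> D n \<Longrightarrow> y = f n x"
proof -
  obtain f :: "nat \<Rightarrow> 'a \<Rightarrow> 'a" where f: "\<And>n. meas_pres \<mu> (f n)" and Rf: "R = {(x, y). \<exists>n. y = f n x}"
    by (rule pmp_rel_graphs[OF R std_space]) (rule that, assumption+)
  have sb: "sets \<mu> = sets borel" using std by (simp add: standard_prob_space_def)
  have fm [measurable]: "f n \<in> \<mu> \<rightarrow>\<^sub>M \<mu>" for n using f by (simp add: meas_pres_def)
  have [measurable]: "f n \<in> borel_measurable \<mu>" for n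
    using fm[of n] measurable_cong_sets[OF refl sb] by blast
  have [measurable]: "(\<lambda>x. x) \<in> borel_measurable \<mu>"
    by (rule measurable_ident_sets[OF sb])
  define \<Gamma> where "\<Gamma> n = {(x, y). y = f n x}" for n
  have [measurable]: "\<Gamma> n \<in> sets (\<mu> \<Otimes>\<^sub>M \<mu>)" for n
  proof -
    have f1: "(\<lambda>p. f n (fst p)) \<in> borel_measurable (\<mu> \<Otimes>\<^sub>M \<mu>)" by measurable
    have f2: "snd \<in> borel_measurable (\<mu> \<Otimes>\<^sub>M \<mu>)"
      using measurable_compose[OF measurable_snd, of "\<lambda>x. x" \<mu> borel \<mu>] by simp
    have "{p \<in> space (\<mu> \<Otimes>\<^sub>M \<mu>). snd p = f n (fst p)} \<in> sets (\<mu> \<Otimes>\<^sub>M \<mu>)"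
      by (rule measurable_equality_set[OF f2 f1])
    also have "{p \<in> space (\<mu> \<Otimes>\<^sub>M \<mu>). snd p = f n (fst p)} = \<Gamma> n"
      by (auto simp: \<Gamma>_def space_pair_measure)
    finally show ?thesis .
  qed
  show ?thesis
  proof (rule that[of "disjointed \<Gamma>" f])
    show "disjointed \<Gamma> n \<in> sets (\<mu> \<Otimes>\<^sub>M \<mu>)" for n
      unfolding disjointed_def by measurable
    show "disjoint_family (disjointed \<Gamma>)" by (rule disjoint_family_disjointed)
    show "R = (\<Union>n. disjointed \<Gamma> n)" by (auto simp: UN_disjointed_eq Rf \<Gamma>_def)
    show "y = f n x" if "(x, y) \<in> disjointed \<Gamma> n" for n x y
      using that disjointed_subset[of \<Gamma> n] by (auto simp: \<Gamma>_def)
  qed (rule fm)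
qed

lemma sets_rel: "R \<in> sets (\<mu> \<Otimes>\<^sub>M \<mu>)"
proof -
  obtain D :: "nat \<Rightarrow> 'a rel" where "\<And>n. D n \<in> sets (\<mu> \<Otimes>\<^sub>M \<mu>)" "R = (\<Union>n. D n)"
    by (rule pmp_rel_disjoint_graphs) (rule that, assumption+)
  then show ?thesis by auto
qed

lemma sets_rel_measure: "sets (rel_measure \<mu> R) = {A \<in> sets (\<mu> \<Otimes>\<^sub>M \<mu>). A \<subseteq> R}"
proof -
  have "{A \<in> sets (\<mu> \<Otimes>\<^sub>M \<mu>). A \<subseteq> R} = sets (restrict_space (\<mu> \<Otimes>\<^sub>M \<mu>) R)"
    using sets_rel by (auto simp: sets_restrict_space_iff image_iff space_pair_measure
        sets_restrict_space Int_absorb1)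
  moreover have "space (restrict_space (\<mu> \<Otimes>\<^sub>M \<mu>) R) = R"
    by (simp add: space_restrict_space space_pair_measure)
  ultimately show ?thesis
    unfolding rel_measure_def by (metis (no_types, lifting) sets.sets_measure_of_eq)
qed

lemma section_card:
  assumes A: "A \<in> sets (\<mu> \<Otimes>\<^sub>M \<mu>)" "A \<subseteq> R" and D: "disjoint_family D" "R = (\<Union>n. D n)"
    and f: "\<And>n x y. (x, y) \<in> D n \<Longrightarrow> y = f n x"
  shows "emeasure (count_space UNIV) (A `` {x}) =
    (\<Sum>n. indicator (A \<inter> D n) (x, f n x))"
proof -
  have "A `` {x} = (\<Union>n. (A \<inter> D n) `` {x})" using A D by auto
  moreover have "disjoint_family (\<lambda>n. (A \<inter> D n) `` {x})"
    using D(1) by (auto simp: disjoint_family_on_def)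
  ultimately have "emeasure (count_space UNIV) (A `` {x}) =
      (\<Sum>n. emeasure (count_space UNIV) ((A \<inter> D n) `` {x}))"
    by (simp add: suminf_emeasure)
  moreover have "emeasure (count_space UNIV) ((A \<inter> D n) `` {x}) =
      indicator (A \<inter> D n) (x, f n x)" for n
  proof (cases "(x, f n x) \<in> A \<inter> D n")
    case True
    then have "(A \<inter> D n) `` {x} = {f n x}" using f by auto
    then show ?thesis using True by simp
  next
    case False
    then have "(A \<inter> D n) `` {x} = {}" using f by auto
    then show ?thesis using False by simp
  qed
  ultimately show ?thesis by simp
qed

lemma emeasure_rel_measure:
  assumes A: "A \<in> sets (\<mu> \<Otimes>\<^sub>M \<mu>)" "A \<subseteq> R"
  shows "emeasure (rel_measure \<mu> R) A = (\<integral>\<^sup>+x. emeasure (count_space UNIV) (A `` {x}) \<partial>\<mu>)"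
proof -
  obtain D :: "nat \<Rightarrow> 'a rel" and f where D: "\<And>n. D n \<in> sets (\<mu> \<Otimes>\<^sub>M \<mu>)" "disjoint_family D" "R = (\<Union>n. D n)"
    and f: "\<And>n. f n \<in> \<mu> \<rightarrow>\<^sub>M \<mu>" "\<And>n x y. (x, y) \<in> D n \<Longrightarrow> y = f n x"
    by (rule pmp_rel_disjoint_graphs) (rule that, assumption+)
  note [measurable] = D(1) f(1)
  have meas: "(\<lambda>x. emeasure (count_space UNIV) (B `` {x})) \<in> borel_measurable \<mu>"
    if [measurable]: "B \<in> sets (\<mu> \<Otimes>\<^sub>M \<mu>)" and "B \<subseteq> R" for B
  proof -
    have "(\<lambda>x. emeasure (count_space UNIV) (B `` {x})) =
        (\<lambda>x. \<Sum>n. indicator (B \<inter> D n) (x, f n x))"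
      by (intro ext section_card that D f)
    also have "\<dots> \<in> borel_measurable \<mu>" by measurable
    finally show ?thesis .
  qed
  show ?thesis
  proof (rule emeasure_measure_of[OF rel_measure_def])
    show "{A \<in> sets (\<mu> \<Otimes>\<^sub>M \<mu>). A \<subseteq> R} \<subseteq> Pow R" by auto
    show "A \<in> sets (rel_measure \<mu> R)" using A by (simp add: sets_rel_measure)
    show "positive (sets (rel_measure \<mu> R))
        (\<lambda>A. \<integral>\<^sup>+x. emeasure (count_space UNIV) (A `` {x}) \<partial>\<mu>)"
      by (simp add: positive_def)
    show "countably_additive (sets (rel_measure \<mu> R))
        (\<lambda>A. \<integral>\<^sup>+x. emeasure (count_space UNIV) (A `` {x}) \<partial>\<mu>)"
    proof (rule countably_additiveI)
      fix B :: "nat \<Rightarrow> 'a rel"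
      assume B: "range B \<subseteq> sets (rel_measure \<mu> R)" "disjoint_family B"
      have "emeasure (count_space UNIV) ((\<Union>n. B n) `` {x}) =
          (\<Sum>n. emeasure (count_space UNIV) (B n `` {x}))" for x
      proof -
        have "disjoint_family (\<lambda>n. B n `` {x})"
          using B(2) by (auto simp: disjoint_family_on_def)
        moreover have "(\<Union>n. B n) `` {x} = (\<Union>n. B n `` {x})" by auto
        ultimately show ?thesis by (simp add: suminf_emeasure)
      qed
      then show "(\<Sum>n. \<integral>\<^sup>+x. emeasure (count_space UNIV) (B n `` {x}) \<partial>\<mu>) =
          (\<integral>\<^sup>+x. emeasure (count_space UNIV) ((\<Union>n. B n) `` {x}) \<partial>\<mu>)"
        using B(1) by (subst nn_integral_suminf[symmetric]) (auto simp: sets_rel_measure intro!: meas)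
    qed
  qed
qed

lemma ex_finite_equiv_measure: "\<exists>m. finite_equiv_measure m (rel_measure \<mu> R)"
proof -
  obtain D :: "nat \<Rightarrow> 'a rel" and f where D: "\<And>n. D n \<in> sets (\<mu> \<Otimes>\<^sub>M \<mu>)" "disjoint_family D" "R = (\<Union>n. D n)"
    and f: "\<And>n x y. (x, y) \<in> D n \<Longrightarrow> y = f n x"
    by (rule pmp_rel_disjoint_graphs) (rule that, assumption+)
  interpret prob_space \<mu> using std by (simp add: standard_prob_space_def)
  have space: "space (rel_measure \<mu> R) = R"
    unfolding rel_measure_def by (rule space_measure_of) auto
  have fin: "emeasure (rel_measure \<mu> R) (D n) \<noteq> \<infinity>" for n
  proof -
    have "emeasure (count_space UNIV) (D n `` {x}) \<le> 1" for x
    proof -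
      have "D n `` {x} \<subseteq> {f n x}" using f by auto
      then have "emeasure (count_space UNIV) (D n `` {x}) \<le> emeasure (count_space UNIV) {f n x}"
        by (intro emeasure_mono) auto
      then show ?thesis by simp
    qed
    then have "(\<integral>\<^sup>+x. emeasure (count_space UNIV) (D n `` {x}) \<partial>\<mu>) \<le> (\<integral>\<^sup>+x. 1 \<partial>\<mu>)"
      by (intro nn_integral_mono)
    also have "\<dots> = 1" using emeasure_space_1 by simp
    finally show ?thesis
      using D by (subst emeasure_rel_measure) (auto simp: top_unique)
  qed
  interpret M: sigma_finite_measure "rel_measure \<mu> R"
    by standard
      (rule exI[of _ "range D"], intro conjI, use D fin space sets_rel_measure in auto)
  obtain h where h: "h \<in> borel_measurable (rel_measure \<mu> R)"
      "integral\<^sup>N (rel_measure \<mu> R) h \<noteq> \<infinity>" "\<forall>x\<in>space (rel_measure \<mu> R). 0 < h x \<and> h x < \<infinity>"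
    using M.Ex_finite_integrable_function by blast
  have "finite_measure (density (rel_measure \<mu> R) h)"
  proof (rule finite_measureI)
    have "emeasure (density (rel_measure \<mu> R) h) (space (rel_measure \<mu> R)) =
        integral\<^sup>N (rel_measure \<mu> R) h"
      by (subst emeasure_density[OF h(1)]) (auto intro!: nn_integral_cong simp: indicator_def)
    with h(2) show "emeasure (density (rel_measure \<mu> R) h)
        (space (density (rel_measure \<mu> R) h)) \<noteq> \<infinity>"
      by simp
  qed
  moreover have "null_sets (density (rel_measure \<mu> R) h) = null_sets (rel_measure \<mu> R)"
  proof (rule Set.set_eqI)
    fix A
    have "A \<in> null_sets (density (rel_measure \<mu> R) h) \<longleftrightarrow>
        A \<in> sets (rel_measure \<mu> R) \<and> (AE x in rel_measure \<mu> R. x \<notin> A)"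
      unfolding null_sets_density_iff[OF h(1)]
      by (intro conj_cong refl AE_cong) (use h(3) in force)
    also have "\<dots> \<longleftrightarrow> A \<in> null_sets (rel_measure \<mu> R)"
      using AE_iff_null_sets[of A] by (auto simp: null_sets_def)
    finally show "A \<in> null_sets (density (rel_measure \<mu> R) h) \<longleftrightarrow> A \<in> null_sets (rel_measure \<mu> R)" .
  qed
  ultimately show ?thesis by (auto simp: finite_equiv_measure_def)
qed

end

end

theory Submission
  imports Defs
begin

text \<open>
  Suppose that \<open>S\<close> is aperiodic of everywhere infinite index.  Given a target \<open>S'\<close>, choose a finite
  subrelation \<open>F\<close> of the hyperfinite relation \<open>R\<close> that carries almost all of \<open>m\<close>, and a
  partial isomorphism inside \<open>R\<close>, of maximal measure, whose domain is \<open>F\<close>-invariant and which turns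
  \<open>S'\<close> into \<open>S\<close> on each \<open>F\<close>-class of its domain.  If the domain were not conull, then neither
  would be the range; on the complement \<open>Z\<close> of the range, by recurrence and infinite index, almost every
  \<open>R\<close>-class contains infinitely many infinite classes of the restriction of \<open>S\<close>.  So \<open>Z\<close>
  contains copies of every finite pattern, in particular of the one that \<open>S'\<close> induces on some
  positive measure family of \<open>F\<close>-classes outside the domain, and ergodicity matches a part of this
  family with such copies, contradicting maximality.  The inverse of the isomorphism moves \<open>S\<close>
  close to \<open>S'\<close>.

  Conversely, if an orbit accumulates at \<open>S'\<close>, then by the Borel-Cantelli lemma some sequence in it converges
  to \<open>S'\<close> pointwise almost everywhere.  For \<open>S' = R\<close> this is impossible if \<open>S\<close> has finite classes on
  a set of positive measure.  For \<open>S' = Id\<close> it is impossible if the restriction of \<open>S\<close> to some \<open>A\<close>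
  has finite index at a positive measure set \<open>B\<close> of points: by mass transport, most points of the translates of
  \<open>B\<close> share their \<open>F\<close>-class, for \<open>F\<close> finite with large classes, with many other points of the
  translate, and two of those are equivalent.
\<close>

subsection \<open>Mass transport\<close>

text \<open>Greedy choice: at stage \<open>n\<close> the current set is enlarged until its value is
  within \<open>1 / real (Suc n)\<close> of that of every member of \<open>\<C>\<close> above it. A
  member above the union competes at every stage, so it gains at most
  \<open>1 / real (Suc n)\<close> for each \<open>n\<close>. This later supplies a partial
  isomorphism whose domain has maximal measure.\<close>

lemma countable_exhaustion:
  fixes \<nu> :: "'b set \<Rightarrow> real"
  assumes ne: "G \<in> \<C>" and bd: "\<And>A. A \<in> \<C> \<Longrightarrow> \<nu> A \<le> B"
    and mono: "\<And>A A'. A \<in> \<C> \<Longrightarrow> A' \<in> \<C> \<Longrightarrow> A \<subseteq> A' \<Longrightarrow> \<nu> A \<le> \<nu> A'"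
    and un: "\<And>A :: nat \<Rightarrow> 'b set. incseq A \<Longrightarrow> (\<And>n. A n \<in> \<C>) \<Longrightarrow> (\<Union>n. A n) \<in> \<C>"
  obtains A where "A \<in> \<C>" "\<And>A'. A' \<in> \<C> \<Longrightarrow> A \<subseteq> A' \<Longrightarrow> \<nu> A' \<le> \<nu> A"
proof -
  have step: "\<exists>A'\<in>\<C>. A \<subseteq> A' \<and> (\<forall>A''\<in>\<C>. A \<subseteq> A'' \<longrightarrow> \<nu> A'' \<le> \<nu> A' + 1 / real (Suc n))"
    if A: "A \<in> \<C>" for A n
  proof -
    define V where "V = \<nu> ` {A'\<in>\<C>. A \<subseteq> A'}"
    have "V \<noteq> {}" "bdd_above V" using A bd by (auto simp: V_def bdd_above_def)
    moreover have "Sup V - 1 / real (Suc n) < Sup V" by simp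
    ultimately obtain v where v: "v \<in> V" "Sup V - 1 / real (Suc n) < v"
      using less_cSup_iff[of V] by blast
    then obtain A' where A': "A' \<in> \<C>" "A \<subseteq> A'" "v = \<nu> A'" by (auto simp: V_def)
    have "\<nu> A'' \<le> \<nu> A' + 1 / real (Suc n)" if "A'' \<in> \<C>" "A \<subseteq> A''" for A''
    proof -
      have "\<nu> A'' \<le> Sup V" using that \<open>bdd_above V\<close> by (intro cSup_upper) (auto simp: V_def)
      then show ?thesis using v(2) A'(3) by linarith
    qed
    then show ?thesis using A'(1,2) by blast
  qed
  have "\<exists>A :: nat \<Rightarrow> 'b set. \<forall>n. A n \<in> \<C> \<and> A n \<subseteq> A (Suc n) \<and>
      (\<forall>A''\<in>\<C>. A n \<subseteq> A'' \<longrightarrow> \<nu> A'' \<le> \<nu> (A (Suc n)) + 1 / real (Suc n))"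
  proof (rule dependent_nat_choice[of "\<lambda>_ A. A \<in> \<C>" "\<lambda>n A A'. A \<subseteq> A' \<and>
      (\<forall>A''\<in>\<C>. A \<subseteq> A'' \<longrightarrow> \<nu> A'' \<le> \<nu> A' + 1 / real (Suc n))"])
    show "\<exists>A. A \<in> \<C>" using ne by blast
  qed (use step in \<open>meson\<close>)
  then obtain A :: "nat \<Rightarrow> 'b set" where A: "\<And>n. A n \<in> \<C>" "\<And>n. A n \<subseteq> A (Suc n)"
    "\<And>n A''. A'' \<in> \<C> \<Longrightarrow> A n \<subseteq> A'' \<Longrightarrow> \<nu> A'' \<le> \<nu> (A (Suc n)) + 1 / real (Suc n)"
    by blast
  have U: "(\<Union>n. A n) \<in> \<C>" by (rule un) (use A in \<open>auto intro: incseq_SucI\<close>)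
  show ?thesis
  proof (rule that[OF U])
    fix A' assume A': "A' \<in> \<C>" "(\<Union>n. A n) \<subseteq> A'"
    show "\<nu> A' \<le> \<nu> (\<Union>n. A n)"
    proof (rule field_le_epsilon)
      fix e :: real assume "e > 0"
      then obtain n where n: "1 / real (Suc n) < e" using nat_approx_posE by blast
      have "\<nu> A' \<le> \<nu> (A (Suc n)) + 1 / real (Suc n)" by (rule A) (use A' in auto)
      moreover have "\<nu> (A (Suc n)) \<le> \<nu> (\<Union>n. A n)" by (rule mono) (use A U in auto)
      ultimately show "\<nu> A' \<le> \<nu> (\<Union>n. A n) + e" using n by linarith
    qed
  qed
qed

section \<open>Countable actions that generate the relation\<close>

text \<open>Of the group only an enumeration of its action is kept, closed under inverses.
  Quantifiers over a class of \<open>R\<close> thus become quantifiers over natural numbers, which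
  makes measurability a matter of countable operations. The enumeration may repeat maps, for
  instance when the group is finite.\<close>

locale pmp_action =
  fixes \<mu> :: "'a::polish_space measure" and R :: "'a rel" and f :: "nat \<Rightarrow> 'a \<Rightarrow> 'a"
  assumes std: "standard_prob_space \<mu>" and pmp: "pmp_rel \<mu> R"
    and mp: "\<And>n. meas_pres \<mu> (f n)"
    and f_inverse: "\<And>n. \<exists>k. \<forall>x. f k (f n x) = x \<and> f n (f k x) = x"
    and R_eq: "R = {(x, y). \<exists>n. y = f n x}"
    and equiv_R: "equiv UNIV R"

lemma ex_pmp_action:
  assumes std: "standard_prob_space \<mu>" and R: "pmp_rel \<mu> R"
  shows "\<exists>f. pmp_action \<mu> R f"
proof -
  have space_UNIV: "space \<mu> = UNIV" by (rule std_space[OF std R])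
  from R space_UNIV obtain G :: "nat monoid" and \<phi> where *: "group_action G UNIV \<phi>"
      "\<forall>g\<in>carrier G. meas_pres \<mu> (\<phi> g)" "R = {(x, y). y \<in> orbit G \<phi> x}"
    by (auto simp: pmp_rel_def)
  interpret group_action G UNIV \<phi> by fact
  interpret group_hom G "BijGroup UNIV" \<phi> by (rule group_hom)
  have ne: "carrier G \<noteq> {}" by auto
  have mem: "from_nat_into (carrier G) n \<in> carrier G" for n by (rule from_nat_into[OF ne])
  have sur: "\<exists>n. g = from_nat_into (carrier G) n" if "g \<in> carrier G" for g
    using that from_nat_into_surj[of "carrier G" g] by auto
  have inv: "\<phi> (inv\<^bsub>G\<^esub> g) (\<phi> g x) = x \<and> \<phi> g (\<phi> (inv\<^bsub>G\<^esub> g) x) = x" if "g \<in> carrier G" for g x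
    using orbit_sym_aux[OF that, of x] orbit_sym_aux[of "inv\<^bsub>G\<^esub> g" x] that by auto
  have eq: "equiv UNIV R"
    unfolding * by (rule equivI)
      (auto simp: refl_on_def sym_def trans_def intro: orbit_refl orbit_sym orbit_trans)
  have "R = {(x, y). \<exists>n. y = \<phi> (from_nat_into (carrier G) n) x}"
    unfolding *(3) orbit_def using mem sur by auto
  moreover have "\<exists>k. \<forall>x. \<phi> (from_nat_into (carrier G) k) (\<phi> (from_nat_into (carrier G) n) x) = x
      \<and> \<phi> (from_nat_into (carrier G) n) (\<phi> (from_nat_into (carrier G) k) x) = x" for n
  proof -
    obtain k where "inv\<^bsub>G\<^esub> (from_nat_into (carrier G) n) = from_nat_into (carrier G) k"
      using sur[of "inv\<^bsub>G\<^esub> (from_nat_into (carrier G) n)"] mem by auto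
    then show ?thesis using inv[OF mem, of n] by metis
  qed
  ultimately have "pmp_action \<mu> R (\<lambda>n. \<phi> (from_nat_into (carrier G) n))"
    using std R *(2) mem eq by (intro pmp_action.intro) auto
  then show ?thesis by blast
qed

context pmp_action
begin

sublocale prob_space \<mu> using std by (simp add: standard_prob_space_def)

abbreviation M :: "('a \<times> 'a) measure" where "M \<equiv> rel_measure \<mu> R"

abbreviation sec_card :: "'a rel \<Rightarrow> 'a \<Rightarrow> ennreal" where
  "sec_card A x \<equiv> emeasure (count_space UNIV) (A `` {x})"

lemma space_UNIV [simp]: "space \<mu> = UNIV" by (rule std_space[OF std pmp])
lemma sets_eq_borel: "sets \<mu> = sets borel" using std by (simp add: standard_prob_space_def)
lemma atomless: "emeasure \<mu> {x} = 0" using std by (simp add: standard_prob_space_def)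
lemma f_meas [measurable]: "f n \<in> \<mu> \<rightarrow>\<^sub>M \<mu>" using mp by (simp add: meas_pres_def)

lemmas sets_M = sets_rel_measure[OF std pmp]
lemmas emeasure_M = emeasure_rel_measure[OF std pmp]
lemma sets_R [measurable]: "R \<in> sets (\<mu> \<Otimes>\<^sub>M \<mu>)" by (rule sets_rel[OF std pmp])

lemma R_refl [simp]: "(x, x) \<in> R" using equiv_R by (auto simp: equiv_def refl_on_def)
lemma R_sym: "(x, y) \<in> R \<Longrightarrow> (y, x) \<in> R" using equiv_R by (meson equiv_def symD)
lemma R_trans: "(x, y) \<in> R \<Longrightarrow> (y, z) \<in> R \<Longrightarrow> (x, z) \<in> R" using equiv_R by (meson equiv_def transD)
lemma R_f [simp]: "(x, f n x) \<in> R" by (auto simp: R_eq)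
lemma R_E: "(x, y) \<in> R \<Longrightarrow> (\<And>n. y = f n x \<Longrightarrow> P) \<Longrightarrow> P" by (auto simp: R_eq)

text \<open>Choosing the inverse among the maps \<open>f k\<close> makes its measurability
  immediate.\<close>

definition finv :: "nat \<Rightarrow> 'a \<Rightarrow> 'a" where
  "finv n = f (SOME k. \<forall>x. f k (f n x) = x \<and> f n (f k x) = x)"

lemma finv_f [simp]: "finv n (f n x) = x" and f_finv [simp]: "f n (finv n x) = x"
  using someI_ex[OF f_inverse[of n]] by (auto simp: finv_def)

lemma finv_meas [measurable]: "finv n \<in> \<mu> \<rightarrow>\<^sub>M \<mu>" by (simp add: finv_def)

lemma f_inj: "f n x = f n y \<Longrightarrow> x = y"
  by (drule arg_cong[of _ _ "finv n"]) (simp only: finv_f)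

lemma finv_eq: "finv n y = x \<longleftrightarrow> y = f n x" by auto

text \<open>Each \<open>f n\<close> preserves the measure, so it pulls a conull set back to a conull
  set; countably many pullbacks are intersected. This upgrades a property of almost every point to a
  property of all points in almost every class.\<close>

lemma AE_saturate:
  assumes "AE x in \<mu>. P x"
  shows "AE x in \<mu>. \<forall>y. (x, y) \<in> R \<longrightarrow> P y"
proof -
  have "AE x in \<mu>. P (f n x)" for n
    using assms mp[of n] by (intro AE_distrD[OF f_meas[of n]]) (metis meas_pres_def)
  then have "AE x in \<mu>. \<forall>n. P (f n x)" by (subst AE_all_countable) (rule allI)
  then show ?thesis by (rule AE_mp) (auto simp: R_eq)
qed

lemma not_AE_D:
  assumes "emeasure \<mu> A > 0" "AE x in \<mu>. x \<notin> A" shows False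
proof (cases "A \<in> sets \<mu>")
  case True
  then show False using assms AE_iff_null_sets[OF True] by auto
next
  case False
  then show False using assms(1) by (simp add: emeasure_notin_sets)
qed

lemma positive_iff: "A \<in> sets \<mu> \<Longrightarrow> emeasure \<mu> A > 0 \<longleftrightarrow> \<not> (AE x in \<mu>. x \<notin> A)"
  using AE_iff_null_sets[of A \<mu>] null_setsD1 null_setsI[of \<mu> A]
  by (metis not_gr_zero)

lemma graph_meas:
  assumes [measurable]: "h \<in> \<mu> \<rightarrow>\<^sub>M \<mu>"
  shows "{(x, y). y = h x} \<in> sets (\<mu> \<Otimes>\<^sub>M \<mu>)"
proof -
  have [measurable]: "h \<in> borel_measurable \<mu>"
    using assms measurable_cong_sets[OF refl sets_eq_borel] by blast
  have [measurable]: "(\<lambda>x. x) \<in> borel_measurable \<mu>" by (rule measurable_ident_sets[OF sets_eq_borel])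
  have f1: "(\<lambda>p. h (fst p)) \<in> borel_measurable (\<mu> \<Otimes>\<^sub>M \<mu>)" by measurable
  have f2: "snd \<in> borel_measurable (\<mu> \<Otimes>\<^sub>M \<mu>)"
    using measurable_compose[OF measurable_snd, of "\<lambda>x. x" \<mu> borel \<mu>] by simp
  have "{p \<in> space (\<mu> \<Otimes>\<^sub>M \<mu>). snd p = h (fst p)} \<in> sets (\<mu> \<Otimes>\<^sub>M \<mu>)"
    by (rule measurable_equality_set[OF f2 f1])
  also have "{p \<in> space (\<mu> \<Otimes>\<^sub>M \<mu>). snd p = h (fst p)} = {(x, y). y = h x}"
    by (auto simp: space_pair_measure)
  finally show ?thesis .
qed

section \<open>Counting along graphs and transporting mass\<close>

lemma disjoint_graphs:
  obtains D where "\<And>n. D n \<in> sets (\<mu> \<Otimes>\<^sub>M \<mu>)" "disjoint_family D" "R = (\<Union>n. D n)"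
    "\<And>n x y. (x, y) \<in> D n \<Longrightarrow> y = f n x"
proof -
  define \<Gamma> where "\<Gamma> n = {(x, y). y = f n x}" for n
  have [measurable]: "\<Gamma> n \<in> sets (\<mu> \<Otimes>\<^sub>M \<mu>)" for n
    unfolding \<Gamma>_def by (rule graph_meas) measurable
  show ?thesis
  proof (rule that[of "disjointed \<Gamma>"])
    show "disjointed \<Gamma> n \<in> sets (\<mu> \<Otimes>\<^sub>M \<mu>)" for n
      unfolding disjointed_def by measurable
    show "disjoint_family (disjointed \<Gamma>)" by (rule disjoint_family_disjointed)
    show "R = (\<Union>n. disjointed \<Gamma> n)" by (auto simp: UN_disjointed_eq R_eq \<Gamma>_def)
    show "y = f n x" if "(x, y) \<in> disjointed \<Gamma> n" for n x y
      using that disjointed_subset[of \<Gamma> n] by (auto simp: \<Gamma>_def)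
  qed
qed

lemma converse_meas [measurable]: "A \<in> sets (\<mu> \<Otimes>\<^sub>M \<mu>) \<Longrightarrow> A\<inverse> \<in> sets (\<mu> \<Otimes>\<^sub>M \<mu>)"
proof -
  assume A: "A \<in> sets (\<mu> \<Otimes>\<^sub>M \<mu>)"
  have "(\<lambda>(x, y). (y, x)) -` A \<inter> space (\<mu> \<Otimes>\<^sub>M \<mu>) \<in> sets (\<mu> \<Otimes>\<^sub>M \<mu>)"
    by (rule measurable_sets[OF measurable_pair_swap' A])
  also have "(\<lambda>(x, y). (y, x)) -` A \<inter> space (\<mu> \<Otimes>\<^sub>M \<mu>) = A\<inverse>"
    by (auto simp: space_pair_measure)
  finally show ?thesis .
qed

lemma converse_subset_R: "A \<subseteq> R \<Longrightarrow> A\<inverse> \<subseteq> R" using R_sym by auto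

lemma sec_card_meas [measurable (raw)]:
  assumes A: "A \<in> sets (\<mu> \<Otimes>\<^sub>M \<mu>)" "A \<subseteq> R"
  shows "sec_card A \<in> borel_measurable \<mu>"
proof -
  obtain D where D: "\<And>n. D n \<in> sets (\<mu> \<Otimes>\<^sub>M \<mu>)" "disjoint_family D" "R = (\<Union>n. D n)"
    and f: "\<And>n x y. (x, y) \<in> D n \<Longrightarrow> y = f n x" by (rule disjoint_graphs) (rule that, assumption+)
  note [measurable] = D(1) A(1)
  have "sec_card A = (\<lambda>x. \<Sum>n. indicator (A \<inter> D n) (x, f n x))"
    by (intro ext section_card[OF std pmp] A D f)
  also have "\<dots> \<in> borel_measurable \<mu>" by measurable
  finally show ?thesis .
qed

text \<open>On a single piece of the graph of \<open>f n\<close> the identity is the change of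
  variables along the measure-preserving map \<open>f n\<close>; summing over a partition of
  \<open>R\<close> into such pieces gives the general case.\<close>

lemma mass_transport:
  assumes A: "A \<in> sets (\<mu> \<Otimes>\<^sub>M \<mu>)" "A \<subseteq> R"
  shows "(\<integral>\<^sup>+x. sec_card A x \<partial>\<mu>) = (\<integral>\<^sup>+x. sec_card (A\<inverse>) x \<partial>\<mu>)"
proof -
  obtain D where D: "\<And>n. D n \<in> sets (\<mu> \<Otimes>\<^sub>M \<mu>)" "disjoint_family D" "R = (\<Union>n. D n)"
    and f: "\<And>n x y. (x, y) \<in> D n \<Longrightarrow> y = f n x" by (rule disjoint_graphs) (rule that, assumption+)
  note [measurable] = D(1) A(1)
  have 1: "sec_card A = (\<lambda>x. \<Sum>n. indicator (A \<inter> D n) (x, f n x))"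
    by (intro ext section_card[OF std pmp] A D f)
  \<comment> \<open>The converses of the pieces are pieces of the graphs of the inverse maps, and
    they again partition \<open>R\<close> by symmetry.\<close>
  have 2: "sec_card (A\<inverse>) = (\<lambda>x. \<Sum>n. indicator (A\<inverse> \<inter> (D n)\<inverse>) (x, finv n x))"
  proof (intro ext section_card[OF std pmp] converse_meas converse_subset_R A)
    show "disjoint_family (\<lambda>n. (D n)\<inverse>)" using D(2) by (auto simp: disjoint_family_on_def)
    have "R = R\<inverse>" using R_sym by auto
    also have "\<dots> = (\<Union>n. (D n)\<inverse>)" by (subst D(3)) auto
    finally show "R = (\<Union>n. (D n)\<inverse>)" .
    show "\<And>n x y. (x, y) \<in> (D n)\<inverse> \<Longrightarrow> y = finv n x" using f finv_f by (metis converse_iff)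
  qed
  have "(\<integral>\<^sup>+x. h (finv n x) x \<partial>\<mu>) = (\<integral>\<^sup>+x. h x (f n x) \<partial>\<mu>)"
    if [measurable]: "case_prod h \<in> borel_measurable (\<mu> \<Otimes>\<^sub>M \<mu>)" for h n
  proof -
    have d: "distr \<mu> \<mu> (f n) = \<mu>" using mp[of n] by (simp only: meas_pres_def)
    have "(\<integral>\<^sup>+x. h (finv n x) x \<partial>distr \<mu> \<mu> (f n)) = (\<integral>\<^sup>+x. h (finv n (f n x)) (f n x) \<partial>\<mu>)"
      by (rule nn_integral_distr) measurable
    then show ?thesis by (simp only: d finv_f)
  qed
  from this[of "\<lambda>x y. indicator (A \<inter> D n) (x, y)" for n]
  have "(\<integral>\<^sup>+x. indicator (A \<inter> D n) (finv n x, x) \<partial>\<mu>) = (\<integral>\<^sup>+x. indicator (A \<inter> D n) (x, f n x) \<partial>\<mu>)" for n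
    by simp
  note e = this
  have 3: "(\<lambda>x. indicator (A\<inverse> \<inter> (D n)\<inverse>) (x, finv n x)) = (\<lambda>x. indicator (A \<inter> D n) (finv n x, x) :: ennreal)" for n
    by (simp add: indicator_def)
  have m: "(\<lambda>x. indicator (A \<inter> D n) (x, f n x) :: ennreal) \<in> borel_measurable \<mu>"
    "(\<lambda>x. indicator (A \<inter> D n) (finv n x, x) :: ennreal) \<in> borel_measurable \<mu>" for n
    by measurable
  have "(\<integral>\<^sup>+x. sec_card A x \<partial>\<mu>) = (\<Sum>n. \<integral>\<^sup>+x. indicator (A \<inter> D n) (x, f n x) \<partial>\<mu>)"
    unfolding 1 by (rule nn_integral_suminf[OF m(1)])
  also have "\<dots> = (\<integral>\<^sup>+x. (\<Sum>n. indicator (A \<inter> D n) (finv n x, x)) \<partial>\<mu>)"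
    unfolding e[symmetric] by (rule nn_integral_suminf[OF m(2), symmetric])
  also have "\<dots> = (\<integral>\<^sup>+x. sec_card (A\<inverse>) x \<partial>\<mu>)"
    unfolding 2 by (simp only: fun_cong[OF 3])
  finally show ?thesis .
qed

lemma null_M_iff:
  assumes A: "A \<in> sets (\<mu> \<Otimes>\<^sub>M \<mu>)" "A \<subseteq> R"
  shows "A \<in> null_sets M \<longleftrightarrow> (AE x in \<mu>. A `` {x} = {})"
proof -
  have "A \<in> null_sets M \<longleftrightarrow> (\<integral>\<^sup>+x. sec_card A x \<partial>\<mu>) = 0"
    using A by (simp add: null_sets_def emeasure_M sets_M)
  also have "\<dots> \<longleftrightarrow> (AE x in \<mu>. sec_card A x = 0)"
    by (rule nn_integral_0_iff_AE) (rule sec_card_meas[OF A])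
  also have "\<dots> \<longleftrightarrow> (AE x in \<mu>. A `` {x} = {})"
    by (intro AE_cong) (auto simp: emeasure_count_space_eq_0)
  finally show ?thesis .
qed

text \<open>An \<open>M\<close>-null set has empty sections over almost every point, and saturating
  this along classes makes it avoid every pair inside almost every class. So statements about almost
  every pair become statements about all pairs of almost every class.\<close>

lemma AE_M_D:
  assumes "AE p in M. P p"
  shows "AE x in \<mu>. \<forall>y z. (x, y) \<in> R \<longrightarrow> (x, z) \<in> R \<longrightarrow> P (y, z)"
proof -
  have sM: "space M = R" unfolding rel_measure_def by (rule space_measure_of) auto
  obtain N where N: "N \<in> null_sets M" "{p \<in> space M. \<not> P p} \<subseteq> N"
    using assms by (auto elim!: AE_E simp: null_sets_def)
  have "AE x in \<mu>. N `` {x} = {}"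
    using N(1) null_M_iff[of N] by (auto simp: null_sets_def sets_M)
  then have "AE x in \<mu>. \<forall>y. (x, y) \<in> R \<longrightarrow> N `` {y} = {}" by (rule AE_saturate)
  then show ?thesis
  proof eventually_elim
    case (elim x)
    show ?case
    proof (intro allI impI)
      fix y z assume xy: "(x, y) \<in> R" "(x, z) \<in> R"
      then have "(y, z) \<in> R" using R_sym R_trans by blast
      moreover have "(y, z) \<notin> N" using elim xy by blast
      ultimately show "P (y, z)" using N(2) sM by auto
    qed
  qed
qed

end

subsection \<open>Recurrence and finite patterns\<close>

text \<open>Points are added one colour at a time. A colour already used takes a fresh point from
  the infinite \<open>S\<close>-class of an earlier point of that colour; a new colour takes a point
  whose class avoids the finitely many classes already met.\<close>

lemma distinct_pattern:
  assumes S: "sym S" "trans S" and X: "infinite (X // restr_rel S Z)" "X \<subseteq> Z" "\<And>y. y \<in> X \<Longrightarrow> (y, y) \<in> S"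
    and inf: "\<And>y. y \<in> X \<Longrightarrow> infinite (S `` {y} \<inter> X)"
  shows "\<exists>ys. length ys = length cs \<and> distinct ys \<and> set ys \<subseteq> X \<and>
    (\<forall>i<length cs. \<forall>j<length cs. (ys ! i, ys ! j) \<in> S \<longleftrightarrow> cs ! i = cs ! j)"
proof (induction cs)
  case Nil
  then show ?case by simp
next
  case (Cons c cs)
  then obtain ys where ys: "length ys = length cs" "distinct ys" "set ys \<subseteq> X"
    "\<And>i j. i < length cs \<Longrightarrow> j < length cs \<Longrightarrow> (ys ! i, ys ! j) \<in> S \<longleftrightarrow> cs ! i = cs ! j"
    by blast
  have "\<exists>y. y \<in> X \<and> y \<notin> set ys \<and> (\<forall>j<length cs. (y, ys ! j) \<in> S \<longleftrightarrow> c = cs ! j)"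
  proof (cases "c \<in> set cs")
    case True
    then obtain i where i: "i < length cs" "c = cs ! i" by (metis in_set_conv_nth)
    then have "ys ! i \<in> X" using ys by force
    then have "infinite (S `` {ys ! i} \<inter> X - set ys)" using inf by simp
    then obtain y where y: "y \<in> S `` {ys ! i} \<inter> X - set ys" using infinite_imp_nonempty by blast
    then have "(ys ! i, y) \<in> S" "(y, ys ! i) \<in> S" using S by (auto dest: symD)
    then have "(y, ys ! j) \<in> S \<longleftrightarrow> (ys ! i, ys ! j) \<in> S" for j using S by (meson transD)
    then show ?thesis using y i ys(4) by auto
  next
    case False
    have "\<not> X // restr_rel S Z \<subseteq> (\<lambda>y. restr_rel S Z `` {y}) ` set ys"
      using X(1) finite_subset by blast
    then obtain y where y: "y \<in> X" "restr_rel S Z `` {y} \<notin> (\<lambda>y. restr_rel S Z `` {y}) ` set ys"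
      by (auto simp: quotient_def)
    have "(y, y') \<notin> S" if y': "y' \<in> set ys" for y'
    proof
      assume *: "(y, y') \<in> S"
      then have "(y', y) \<in> S" using S by (auto dest: symD)
      have "(y, z) \<in> S \<longleftrightarrow> (y', z) \<in> S" for z
        using * \<open>(y', y) \<in> S\<close> S by (meson transD)
      then have "restr_rel S Z `` {y} = restr_rel S Z `` {y'}"
        using y(1) y' ys(3) X(2) by (auto simp: restr_rel_def)
      then show False using y y' by auto
    qed
    moreover have "c \<noteq> cs ! j" if "j < length cs" for j using False that by auto
    moreover have "y \<notin> set ys" using y by auto
    ultimately show ?thesis using y(1) ys(1) by (intro exI[of _ y]) auto
  qed
  then obtain y where y: "y \<in> X" "y \<notin> set ys" "\<And>j. j < length cs \<Longrightarrow> (y, ys ! j) \<in> S \<longleftrightarrow> c = cs ! j" by blast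
  then have y': "(ys ! j, y) \<in> S \<longleftrightarrow> cs ! j = c" if "j < length cs" for j
    using that S by (metis symD)
  show ?case
  proof (intro exI[of _ "y # ys"] conjI allI impI)
    fix i j assume "i < length (c # cs)" "j < length (c # cs)"
    then show "((y # ys) ! i, (y # ys) ! j) \<in> S \<longleftrightarrow> (c # cs) ! i = (c # cs) ! j"
      using X(3)[OF y(1)] y(3) y' ys(4) by (cases i; cases j) auto
  qed (use ys y in auto)
qed

context pmp_action
begin

text \<open>Each point of \<open>W\<close> receives unit mass from every point of its \<open>E\<close>-class, and a point sends
  out mass at most \<open>n\<close>.\<close>

lemma transport_bound:
  assumes E [measurable]: "E \<in> sets (\<mu> \<Otimes>\<^sub>M \<mu>)" and "E \<subseteq> R" "sym E" "trans E"
    and W [measurable]: "W \<in> sets \<mu>" and n: "\<And>y. y \<in> W \<Longrightarrow> emeasure (count_space UNIV) (E `` {y} \<inter> W) \<le> n"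
  shows "(\<integral>\<^sup>+y. sec_card E y * indicator W y \<partial>\<mu>) \<le> n"
proof -
  define A where "A = E \<inter> (UNIV \<times> W)"
  have U [measurable]: "UNIV \<in> sets \<mu>" using sets.top[of \<mu>] by simp
  have A: "A \<in> sets (\<mu> \<Otimes>\<^sub>M \<mu>)" "A \<subseteq> R" using assms(2) unfolding A_def by auto
  have "sec_card (A\<inverse>) y = sec_card E y * indicator W y" for y
  proof -
    have "A\<inverse> `` {y} = (if y \<in> W then E `` {y} else {})"
      using \<open>sym E\<close> by (auto simp: A_def dest: symD)
    then show ?thesis by auto
  qed
  then have "(\<integral>\<^sup>+y. sec_card E y * indicator W y \<partial>\<mu>) = (\<integral>\<^sup>+y. sec_card A y \<partial>\<mu>)"
    using mass_transport[OF A] by simp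
  also have "\<dots> \<le> (\<integral>\<^sup>+y. n \<partial>\<mu>)"
  proof (intro nn_integral_mono)
    fix x
    show "sec_card A x \<le> n"
    proof (cases "A `` {x} = {}")
      case False
      then obtain y where y: "(x, y) \<in> E" "y \<in> W" by (auto simp: A_def)
      then have "A `` {x} \<subseteq> E `` {y} \<inter> W"
        using \<open>sym E\<close> \<open>trans E\<close> by (auto simp: A_def dest: symD transD)
      then have "sec_card A x \<le> emeasure (count_space UNIV) (E `` {y} \<inter> W)"
        by (intro emeasure_mono) auto
      then show ?thesis using n[OF y(2)] by simp
    qed simp
  qed
  also have "\<dots> = n" by (simp add: emeasure_space_1[simplified])
  finally show ?thesis .
qed

lemma subrel_D:
  assumes "subrel \<mu> R S"
  shows "S \<in> sets (\<mu> \<Otimes>\<^sub>M \<mu>)" "S \<subseteq> R" "sym S" "trans S" "\<And>x. (x, x) \<in> S"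
  using assms by (auto simp: subrel_def equiv_def refl_on_def)

text \<open>A form of Poincare recurrence. Let \<open>W\<close> consist of the points of
  \<open>Z\<close> whose \<open>S\<close>-class meets \<open>Z\<close> at most \<open>n\<close>
  times. Every point of \<open>W\<close> receives mass from an infinite class while the mass sent
  out by any point is at most \<open>n\<close>, so \<open>\<infinity> * emeasure \<mu> W\<close> is
  finite and \<open>W\<close> is null.\<close>

lemma recurrence:
  assumes S: "subrel \<mu> R S" and ap: "aperiodic_rel \<mu> S" and Z: "Z \<in> sets \<mu>"
  shows "AE x in \<mu>. x \<in> Z \<longrightarrow> infinite (S `` {x} \<inter> Z)"
proof -
  note SD = subrel_D[OF S]
  note [measurable] = SD(1) Z
  have U [measurable]: "UNIV \<in> sets \<mu>" using sets.top[of \<mu>] by simp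
  define SZ where "SZ = S \<inter> (UNIV \<times> Z)"
  have SZ: "SZ \<in> sets (\<mu> \<Otimes>\<^sub>M \<mu>)" "SZ \<subseteq> R" using SD(2) unfolding SZ_def by auto
  note [measurable] = sec_card_meas[OF SZ]
  have "AE x in \<mu>. \<not> (x \<in> Z \<and> sec_card SZ x \<le> of_nat n)" for n
  proof -
    define W where "W = {x \<in> space \<mu>. x \<in> Z \<and> sec_card SZ x \<le> of_nat n}"
    have W [measurable]: "W \<in> sets \<mu>" unfolding W_def by measurable
    have "(\<integral>\<^sup>+y. sec_card S y * indicator W y \<partial>\<mu>) \<le> of_nat n"
    proof (rule transport_bound)
      fix y assume y: "y \<in> W"
      have "S `` {y} \<inter> W \<subseteq> SZ `` {y}" by (auto simp: W_def SZ_def)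
      then have "emeasure (count_space UNIV) (S `` {y} \<inter> W) \<le> sec_card SZ y"
        by (intro emeasure_mono) auto
      then show "emeasure (count_space UNIV) (S `` {y} \<inter> W) \<le> of_nat n"
        using y by (auto simp: W_def)
    qed (use SD W in auto)
    moreover have "(\<integral>\<^sup>+y. sec_card S y * indicator W y \<partial>\<mu>) = (\<integral>\<^sup>+y. \<infinity> * indicator W y \<partial>\<mu>)"
    proof (rule nn_integral_cong_AE)
      from ap have "AE x in \<mu>. infinite (S `` {x})" by (simp add: aperiodic_rel_def)
      then show "AE y in \<mu>. sec_card S y * indicator W y = \<infinity> * indicator W y"
        by eventually_elim simp
    qed
    moreover have "(\<integral>\<^sup>+y. \<infinity> * indicator W y \<partial>\<mu>) = \<infinity> * emeasure \<mu> W"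
      by (rule nn_integral_cmult_indicator) (rule W)
    ultimately have "emeasure \<mu> W = 0"
      by (metis ennreal_mult_eq_top_iff ennreal_of_nat_neq_top infinity_ennreal_def top.extremum_unique ennreal_top_mult)
    then have "AE x in \<mu>. x \<notin> W" using W by (intro AE_not_in) auto
    then show ?thesis by eventually_elim (auto simp: W_def)
  qed
  then have "AE x in \<mu>. \<forall>n. \<not> (x \<in> Z \<and> sec_card SZ x \<le> of_nat n)"
    by (subst AE_all_countable) (rule allI)
  then show ?thesis
  proof eventually_elim
    case (elim x)
    have "SZ `` {x} = S `` {x} \<inter> Z" by (auto simp: SZ_def)
    then show ?case using elim by (auto simp: emeasure_count_space)
  qed
qed

text \<open>Inside the part of an \<open>R\<close>-class that lies in \<open>Z\<close>, infinite
  index provides infinitely many \<open>S\<close>-classes, and recurrence, saturated along the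
  \<open>R\<close>-class, makes each of them infinite. This is exactly what
  \<open>distinct_pattern\<close> asks for.\<close>

lemma AE_ex_pattern:
  assumes S: "subrel \<mu> R S" and ap: "aperiodic_rel \<mu> S" and ind: "everywhere_infinite_index \<mu> S R"
    and Z: "Z \<in> sets \<mu>"
  shows "AE x in \<mu>. x \<in> Z \<longrightarrow> (\<exists>ys. length ys = length cs \<and> distinct ys \<and> set ys \<subseteq> R `` {x} \<inter> Z \<and>
    (\<forall>i<length cs. \<forall>j<length cs. (ys ! i, ys ! j) \<in> S \<longleftrightarrow> cs ! i = cs ! j))"
proof (cases "emeasure \<mu> Z > 0")
  case False
  then have "AE x in \<mu>. x \<notin> Z" using Z by (intro AE_not_in) (auto simp: null_sets_def)
  then show ?thesis by eventually_elim auto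
next
  case True
  note SD = subrel_D[OF S]
  have "AE x in \<mu>. x \<in> Z \<longrightarrow> infinite ((restr_rel R Z `` {x}) // restr_rel S Z)"
    using ind Z True by (auto simp: everywhere_infinite_index_def)
  moreover have "AE x in \<mu>. \<forall>y. (x, y) \<in> R \<longrightarrow> (y \<in> Z \<longrightarrow> infinite (S `` {y} \<inter> Z))"
    using recurrence[OF S ap Z] by (rule AE_saturate)
  ultimately show ?thesis
  proof eventually_elim
    case (elim x)
    show ?case
    proof
      assume x: "x \<in> Z"
      have *: "restr_rel R Z `` {x} = R `` {x} \<inter> Z" using x by (auto simp: restr_rel_def)
      show "\<exists>ys. length ys = length cs \<and> distinct ys \<and> set ys \<subseteq> R `` {x} \<inter> Z \<and>
          (\<forall>i<length cs. \<forall>j<length cs. (ys ! i, ys ! j) \<in> S \<longleftrightarrow> cs ! i = cs ! j)"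
      proof (rule distinct_pattern[where Z = Z])
        fix y assume y: "y \<in> R `` {x} \<inter> Z"
        have "S `` {y} \<inter> (R `` {x} \<inter> Z) = S `` {y} \<inter> Z"
          using y SD(2) R_trans by blast
        then show "infinite (S `` {y} \<inter> (R `` {x} \<inter> Z))" using y elim by auto
      qed (use SD elim x * in auto)
    qed
  qed
qed

text \<open>The labels take countably many values and separate finite sets of points; fixing the labels of
  finitely many distinct translates of a point makes the translates of a set disjoint.\<close>

definition basis_seq :: "nat \<Rightarrow> 'a set" where
  "basis_seq = (SOME B. (\<forall>k. open (B k)) \<and> (\<forall>x y. x \<noteq> y \<longrightarrow> (\<exists>k. x \<in> B k \<and> y \<notin> B k)))"

lemma basis_seq: "open (basis_seq k)" "x \<noteq> y \<Longrightarrow> \<exists>k. x \<in> basis_seq k \<and> y \<notin> basis_seq k"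
proof -
  obtain \<B> :: "'a set set" where B: "countable \<B>" "topological_basis \<B>"
    using ex_countable_basis by blast
  have ne: "\<B> \<noteq> {}" using topological_basisE[OF B(2) open_UNIV UNIV_I] by blast
  have "(\<forall>k. open (from_nat_into \<B> k)) \<and>
    (\<forall>x y. x \<noteq> y \<longrightarrow> (\<exists>k. x \<in> from_nat_into \<B> k \<and> y \<notin> from_nat_into \<B> k))"
  proof (intro conjI allI impI)
    show "open (from_nat_into \<B> k)" for k
      using topological_basis_open[OF B(2)] from_nat_into[OF ne] by blast
    fix x y :: 'a assume "x \<noteq> y"
    then obtain U where "open U" "x \<in> U" "y \<notin> U" using t1_space by blast
    then obtain B' where "B' \<in> \<B>" "x \<in> B'" "B' \<subseteq> U" using topological_basisE[OF B(2)] by metis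
    then show "\<exists>k. x \<in> from_nat_into \<B> k \<and> y \<notin> from_nat_into \<B> k"
      using from_nat_into_surj[OF B(1), of B'] \<open>y \<notin> U\<close> by blast
  qed
  then have "\<exists>B :: nat \<Rightarrow> 'a set. (\<forall>k. open (B k)) \<and> (\<forall>x y. x \<noteq> y \<longrightarrow> (\<exists>k. x \<in> B k \<and> y \<notin> B k))" by blast
  then have *: "(\<forall>k. open (basis_seq k)) \<and> (\<forall>x y. x \<noteq> y \<longrightarrow> (\<exists>k. x \<in> basis_seq k \<and> y \<notin> basis_seq k))"
    unfolding basis_seq_def by (rule someI_ex)
  then show "open (basis_seq k)" "x \<noteq> y \<Longrightarrow> \<exists>k. x \<in> basis_seq k \<and> y \<notin> basis_seq k" by blast+
qed

definition label :: "nat \<Rightarrow> 'a \<Rightarrow> bool list" where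
  "label m x = map (\<lambda>k. x \<in> basis_seq k) [0..<m]"

lemma label_eq_iff: "label m x = u \<longleftrightarrow> length u = m \<and> (\<forall>k<m. (x \<in> basis_seq k) = u ! k)"
  by (auto simp: label_def list_eq_iff_nth_eq)

lemma label_meas [measurable]: "label m \<in> \<mu> \<rightarrow>\<^sub>M count_space UNIV"
  unfolding measurable_count_space_eq2_countable
proof (intro conjI ballI)
  fix u
  have [measurable]: "basis_seq k \<in> sets \<mu>" for k by (simp add: sets_eq_borel basis_seq borel_open)
  have "{x \<in> space \<mu>. length u = m \<and> (\<forall>k<m. (x \<in> basis_seq k) = u ! k)} \<in> sets \<mu>" by measurable
  also have "{x \<in> space \<mu>. length u = m \<and> (\<forall>k<m. (x \<in> basis_seq k) = u ! k)} = label m -` {u} \<inter> space \<mu>"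
    by (simp add: set_eq_iff label_eq_iff)
  finally show "label m -` {u} \<inter> space \<mu> \<in> sets \<mu>" .
qed auto

lemma label_separates:
  assumes "finite X" shows "\<exists>m. inj_on (label m) X"
proof -
  have "\<exists>k. \<forall>x y. x \<noteq> y \<longrightarrow> x \<in> basis_seq (k x y) \<and> y \<notin> basis_seq (k x y)"
    using basis_seq(2) by metis
  then obtain k where k: "\<And>x y. x \<noteq> y \<Longrightarrow> x \<in> basis_seq (k x y) \<and> y \<notin> basis_seq (k x y)" by blast
  \<comment> \<open>All separating indices lie below \<open>m\<close>, since labels record only the
    indices less than \<open>m\<close>. For empty \<open>X\<close> the maximum is unspecified, but
    injectivity is then vacuous.\<close>
  define m where "m = Suc (Max ((\<lambda>(x, y). k x y) ` (X \<times> X)))"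
  have m: "k x y < m" if "x \<in> X" "y \<in> X" for x y
    unfolding m_def less_Suc_eq_le using assms that by (intro Max_ge) auto
  show ?thesis
  proof (intro exI[of _ m] inj_onI)
    fix x y assume xy: "x \<in> X" "y \<in> X" "label m x = label m y"
    then have "\<forall>k<m. (x \<in> basis_seq k) = (y \<in> basis_seq k)" by (auto simp: label_def)
    then show "x = y" using k m xy by metis
  qed
qed

text \<open>If every member of the countable cover were null, so would be \<open>X\<close>. It is
  used with finite codes, to pass from a configuration that exists at almost every point to one
  fixed code valid on a positive measure set.\<close>

lemma countable_cover:
  fixes A :: "'c::countable \<Rightarrow> 'a set"
  assumes X: "emeasure \<mu> X > 0" and c: "AE x in \<mu>. x \<in> X \<longrightarrow> (\<exists>c. x \<in> A c)" and A: "\<And>c. A c \<in> sets \<mu>"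
  shows "\<exists>c. emeasure \<mu> (A c) > 0"
proof (rule ccontr)
  assume "\<nexists>c. emeasure \<mu> (A c) > 0"
  then have "AE x in \<mu>. x \<notin> A c" for c using A by (intro AE_not_in) (auto simp: null_sets_def)
  then have "AE x in \<mu>. \<forall>c. x \<notin> A c" by (subst AE_all_countable) (rule allI)
  with c have "AE x in \<mu>. x \<notin> X" by eventually_elim auto
  then show False using X not_AE_D by blast
qed

end

subsection \<open>Partial isomorphisms\<close>

text \<open>The two relations are compared only within a class of \<open>F\<close>, and the domain
  is a union of such classes. Hence pieces with disjoint domains and disjoint ranges can be glued
  without any condition across pieces.\<close>

definition partial_iso :: "'a rel \<Rightarrow> 'a rel \<Rightarrow> 'a rel \<Rightarrow> 'a rel \<Rightarrow> bool" where
  "partial_iso F S' S \<Gamma> \<longleftrightarrow> single_valued \<Gamma> \<and> single_valued (\<Gamma>\<inverse>) \<and>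
    (\<forall>x y. (x, y) \<in> F \<longrightarrow> x \<in> Domain \<Gamma> \<longrightarrow> y \<in> Domain \<Gamma>) \<and>
    (\<forall>x x' y y'. (x, x') \<in> \<Gamma> \<longrightarrow> (y, y') \<in> \<Gamma> \<longrightarrow> (x, y) \<in> F \<longrightarrow> ((x', y') \<in> S \<longleftrightarrow> (x, y) \<in> S'))"

lemma partial_isoD:
  assumes "partial_iso F S' S \<Gamma>"
  shows "\<And>x y z. (x, y) \<in> \<Gamma> \<Longrightarrow> (x, z) \<in> \<Gamma> \<Longrightarrow> y = z"
    "\<And>x y z. (x, z) \<in> \<Gamma> \<Longrightarrow> (y, z) \<in> \<Gamma> \<Longrightarrow> x = y"
    "\<And>x y. (x, y) \<in> F \<Longrightarrow> x \<in> Domain \<Gamma> \<Longrightarrow> y \<in> Domain \<Gamma>"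
    "\<And>x x' y y'. (x, x') \<in> \<Gamma> \<Longrightarrow> (y, y') \<in> \<Gamma> \<Longrightarrow> (x, y) \<in> F \<Longrightarrow> (x', y') \<in> S \<longleftrightarrow> (x, y) \<in> S'"
  using assms unfolding partial_iso_def single_valued_def converse_iff by meson+

lemma partial_isoI:
  assumes "\<And>x y z. (x, y) \<in> \<Gamma> \<Longrightarrow> (x, z) \<in> \<Gamma> \<Longrightarrow> y = z"
    "\<And>x y z. (x, z) \<in> \<Gamma> \<Longrightarrow> (y, z) \<in> \<Gamma> \<Longrightarrow> x = y"
    "\<And>x y. (x, y) \<in> F \<Longrightarrow> x \<in> Domain \<Gamma> \<Longrightarrow> y \<in> Domain \<Gamma>"
    "\<And>x x' y y'. (x, x') \<in> \<Gamma> \<Longrightarrow> (y, y') \<in> \<Gamma> \<Longrightarrow> (x, y) \<in> F \<Longrightarrow> (x', y') \<in> S \<longleftrightarrow> (x, y) \<in> S'"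
  shows "partial_iso F S' S \<Gamma>"
  unfolding partial_iso_def single_valued_def converse_iff using assms by meson

lemma partial_iso_Union:
  fixes A :: "nat \<Rightarrow> 'a rel"
  assumes "incseq A" "\<And>n. partial_iso F S' S (A n)"
  shows "partial_iso F S' S (\<Union>n. A n)"
proof -
  have *: "\<exists>n. p \<in> A n \<and> q \<in> A n" if "p \<in> (\<Union>n. A n)" "q \<in> (\<Union>n. A n)" for p q
  proof -
    from that obtain i j where "p \<in> A i" "q \<in> A j" by auto
    then show ?thesis using incseqD[OF assms(1), of i "max i j"] incseqD[OF assms(1), of j "max i j"] by auto
  qed
  note A = partial_isoD[OF assms(2)]
  show ?thesis
  proof (rule partial_isoI)
    show "y = z" if "(x, y) \<in> (\<Union>n. A n)" "(x, z) \<in> (\<Union>n. A n)" for x y z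
      using *[OF that] A(1) by blast
    show "x = y" if "(x, z) \<in> (\<Union>n. A n)" "(y, z) \<in> (\<Union>n. A n)" for x y z
      using *[OF that] A(2) by blast
    show "y \<in> Domain (\<Union>n. A n)" if xy: "(x, y) \<in> F" "x \<in> Domain (\<Union>n. A n)" for x y
    proof -
      from xy(2) obtain n where "x \<in> Domain (A n)" by auto
      then show ?thesis using A(3)[OF xy(1)] by blast
    qed
    show "((x', y') \<in> S) = ((x, y) \<in> S')"
      if "(x, x') \<in> (\<Union>n. A n)" "(y, y') \<in> (\<Union>n. A n)" "(x, y) \<in> F" for x x' y y'
      using *[OF that(1,2)] A(4) that(3) by blast
  qed
qed

text \<open>Both domains are invariant under \<open>F\<close> and disjoint, so a point of one is
  never \<open>F\<close>-related to a point of the other; the mixed cases of the comparison are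
  vacuous.\<close>

lemma partial_iso_Un:
  assumes "partial_iso F S' S \<Gamma>" "partial_iso F S' S \<Delta>" "sym F"
    and dom: "Domain \<Gamma> \<inter> Domain \<Delta> = {}" and ran: "Range \<Gamma> \<inter> Range \<Delta> = {}"
  shows "partial_iso F S' S (\<Gamma> \<union> \<Delta>)"
proof -
  note G = partial_isoD[OF assms(1)] and D = partial_isoD[OF assms(2)]
  show ?thesis
  proof (rule partial_isoI)
    show "y = z" if "(x, y) \<in> \<Gamma> \<union> \<Delta>" "(x, z) \<in> \<Gamma> \<union> \<Delta>" for x y z
      using that G(1) D(1) dom by blast
    show "x = y" if "(x, z) \<in> \<Gamma> \<union> \<Delta>" "(y, z) \<in> \<Gamma> \<union> \<Delta>" for x y z
      using that G(2) D(2) ran by blast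
    show "y \<in> Domain (\<Gamma> \<union> \<Delta>)" if "(x, y) \<in> F" "x \<in> Domain (\<Gamma> \<union> \<Delta>)" for x y
      using G(3)[OF that(1)] D(3)[OF that(1)] that(2) by auto
    fix x x' y y' assume xy: "(x, x') \<in> \<Gamma> \<union> \<Delta>" "(y, y') \<in> \<Gamma> \<union> \<Delta>" "(x, y) \<in> F"
    have yx: "(y, x) \<in> F" using xy(3) \<open>sym F\<close> by (auto dest: symD)
    consider "(x, x') \<in> \<Gamma>" "(y, y') \<in> \<Gamma>" | "(x, x') \<in> \<Delta>" "(y, y') \<in> \<Delta>"
      | "x \<in> Domain \<Gamma>" "y \<in> Domain \<Delta>" | "x \<in> Domain \<Delta>" "y \<in> Domain \<Gamma>"
      using xy by blast
    then show "((x', y') \<in> S) = ((x, y) \<in> S')"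
    proof cases
      case 1 then show ?thesis using G(4) xy(3) by blast
    next
      case 2 then show ?thesis using D(4) xy(3) by blast
    next
      case 3 then show ?thesis using G(3)[OF xy(3)] dom by blast
    next
      case 4 then show ?thesis using D(3)[OF xy(3)] dom by blast
    qed
  qed
qed

lemma map_prod_image_iff:
  assumes T: "\<And>x. T (U x) = x" "\<And>x. U (T x) = x"
  shows "(x, y) \<in> map_prod T T ` A \<longleftrightarrow> (U x, U y) \<in> A"
proof
  assume "(x, y) \<in> map_prod T T ` A"
  then show "(U x, U y) \<in> A" using T(2) by auto
next
  assume "(U x, U y) \<in> A"
  then show "(x, y) \<in> map_prod T T ` A"
    by (intro image_eqI[of _ _ "(U x, U y)"]) (simp add: T(1))
qed

section \<open>From partial isomorphisms to elements of the full group\<close>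

context pmp_action
begin

lemma Domain_meas [measurable]:
  assumes [measurable]: "\<Gamma> \<in> sets (\<mu> \<Otimes>\<^sub>M \<mu>)" and "\<Gamma> \<subseteq> R"
  shows "Domain \<Gamma> \<in> sets \<mu>"
proof -
  have "{x \<in> space \<mu>. \<exists>n. (x, f n x) \<in> \<Gamma>} \<in> sets \<mu>" by measurable
  also have "{x \<in> space \<mu>. \<exists>n. (x, f n x) \<in> \<Gamma>} = Domain \<Gamma>"
    using \<open>\<Gamma> \<subseteq> R\<close> by (auto simp: R_eq)
  finally show ?thesis .
qed

lemma Range_meas [measurable]:
  assumes "\<Gamma> \<in> sets (\<mu> \<Otimes>\<^sub>M \<mu>)" and "\<Gamma> \<subseteq> R"
  shows "Range \<Gamma> \<in> sets \<mu>"
  using Domain_meas[OF converse_meas converse_subset_R, OF assms] by simp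

lemma sec_card_single_valued: "single_valued \<Gamma> \<Longrightarrow> sec_card \<Gamma> x = indicator (Domain \<Gamma>) x"
proof (cases "x \<in> Domain \<Gamma>")
  case True
  assume "single_valued \<Gamma>"
  with True obtain y where "\<Gamma> `` {x} = {y}" by (auto simp: single_valued_def)
  then show ?thesis using True by simp
next
  case False
  then have "\<Gamma> `` {x} = {}" by auto
  then show ?thesis using False by simp
qed

lemma emeasure_M_Domain:
  assumes "\<Gamma> \<in> sets (\<mu> \<Otimes>\<^sub>M \<mu>)" and "\<Gamma> \<subseteq> R" and "single_valued \<Gamma>"
  shows "emeasure M \<Gamma> = emeasure \<mu> (Domain \<Gamma>)"
  using assms by (simp add: emeasure_M sec_card_single_valued Domain_meas)

text \<open>With \<open>emeasure_M_Domain\<close> this computes the mass of an injective graph from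
  both sides: by mass transport, a partial injection inside \<open>R\<close> has domain and range of
  equal measure.\<close>

lemma emeasure_M_Range:
  assumes "\<Gamma> \<in> sets (\<mu> \<Otimes>\<^sub>M \<mu>)" and "\<Gamma> \<subseteq> R" and "single_valued (\<Gamma>\<inverse>)"
  shows "emeasure M \<Gamma> = emeasure \<mu> (Range \<Gamma>)"
  using assms
  by (simp add: emeasure_M mass_transport[OF assms(1,2)] sec_card_single_valued Range_meas)

lemma AE_conull: "A \<in> sets \<mu> \<Longrightarrow> (AE x in \<mu>. x \<in> A) \<longleftrightarrow> emeasure \<mu> A = 1"
  using emeasure_eq_1_AE AE_in_set_eq_1 by (auto simp: emeasure_eq_measure)

text \<open>The range has the same measure as the domain, hence is conull too. The points whose
  whole \<open>R\<close>-class lies in both sets form an invariant conull set \<open>good\<close>;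
  there \<open>T\<close> follows \<open>\<Gamma>\<close>, and elsewhere it is the identity.
  Invariance of \<open>good\<close> makes the two parts fit into a bijection of the whole
  space.\<close>

lemma full_iso_of_partial:
  assumes G: "\<Gamma> \<in> sets (\<mu> \<Otimes>\<^sub>M \<mu>)" "\<Gamma> \<subseteq> R" "single_valued \<Gamma>" "single_valued (\<Gamma>\<inverse>)"
    and dom: "AE x in \<mu>. x \<in> Domain \<Gamma>"
  obtains T U where "\<And>x. T (U x) = x" "\<And>x. U (T x) = x" "T \<in> \<mu> \<rightarrow>\<^sub>M \<mu>" "U \<in> \<mu> \<rightarrow>\<^sub>M \<mu>"
    "\<And>x. (x, T x) \<in> R" "AE x in \<mu>. (x, T x) \<in> \<Gamma>"
proof -
  note [measurable] = G(1)
  have [measurable]: "Domain \<Gamma> \<in> sets \<mu>" "Range \<Gamma> \<in> sets \<mu>" using G by measurable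
  have "emeasure \<mu> (Range \<Gamma>) = 1"
    using dom G emeasure_M_Domain[of \<Gamma>] emeasure_M_Range[of \<Gamma>] AE_conull[of "Domain \<Gamma>"] by simp
  then have ran: "AE x in \<mu>. x \<in> Range \<Gamma>" using AE_conull[of "Range \<Gamma>"] by simp
  define good where "good = {x. \<forall>n. f n x \<in> Domain \<Gamma> \<and> f n x \<in> Range \<Gamma>}"
  have good_R: "x \<in> good \<longleftrightarrow> (\<forall>y. (x, y) \<in> R \<longrightarrow> y \<in> Domain \<Gamma> \<and> y \<in> Range \<Gamma>)" for x
    by (auto simp: good_def R_eq)
  have good_inv: "y \<in> good" if "x \<in> good" "(x, y) \<in> R" for x y
    using that R_trans unfolding good_R by blast
  have "{x \<in> space \<mu>. \<forall>n. f n x \<in> Domain \<Gamma> \<and> f n x \<in> Range \<Gamma>} \<in> sets \<mu>" by measurable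
  then have [measurable]: "good \<in> sets \<mu>" by (simp add: good_def)
  have good_AE: "AE x in \<mu>. x \<in> good"
  proof -
    have "AE x in \<mu>. x \<in> Domain \<Gamma> \<and> x \<in> Range \<Gamma>" using dom ran by eventually_elim auto
    then show ?thesis unfolding good_R by (rule AE_saturate)
  qed
  define T where "T x = (if x \<in> good then THE y. (x, y) \<in> \<Gamma> else x)" for x
  define U where "U y = (if y \<in> good then THE x. (x, y) \<in> \<Gamma> else y)" for y
  have T_eq: "T x = y" if "x \<in> good" "(x, y) \<in> \<Gamma>" for x y
    unfolding T_def using that G(3) by (auto simp: single_valued_def)
  have U_eq: "U y = x" if "y \<in> good" "(x, y) \<in> \<Gamma>" for x y
    unfolding U_def using that G(4) by (auto simp: single_valued_def)
  have T_G: "(x, T x) \<in> \<Gamma>" if x: "x \<in> good" for x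
  proof -
    have "x \<in> Domain \<Gamma>" using x good_R by auto
    then obtain y where "(x, y) \<in> \<Gamma>" by auto
    then show ?thesis using T_eq[OF x] by simp
  qed
  have U_G: "(U x, x) \<in> \<Gamma>" if x: "x \<in> good" for x
  proof -
    have "x \<in> Range \<Gamma>" using x good_R by auto
    then obtain y where "(y, x) \<in> \<Gamma>" by auto
    then show ?thesis using U_eq[OF x] by simp
  qed
  have TR: "(x, T x) \<in> R" for x
    using T_G[of x] G(2) by (cases "x \<in> good") (auto simp: T_def)
  have UR: "(x, U x) \<in> R" for x
    using U_G[of x] G(2) R_sym by (cases "x \<in> good") (auto simp: U_def)
  have TU: "T (U x) = x" for x
  proof (cases "x \<in> good")
    case True
    then show ?thesis using T_eq[OF good_inv[OF True UR] U_G[OF True]] by simp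
  qed (simp add: T_def U_def)
  have UT: "U (T x) = x" for x
  proof (cases "x \<in> good")
    case True
    then show ?thesis using U_eq[OF good_inv[OF True TR] T_G[OF True]] by simp
  qed (simp add: T_def U_def)
  have "T \<in> \<mu> \<rightarrow>\<^sub>M \<mu>"
  proof (rule measurableI)
    fix A assume [measurable]: "A \<in> sets \<mu>"
    \<comment> \<open>The value of \<open>T\<close> at a point of \<open>good\<close> is one of the
      countably many points \<open>f n x\<close>, so its preimages are described by countable
      unions.\<close>
    have "{x \<in> space \<mu>. if x \<in> good then \<exists>n. (x, f n x) \<in> \<Gamma> \<and> f n x \<in> A else x \<in> A} \<in> sets \<mu>"
      by measurable
    also have "{x \<in> space \<mu>. if x \<in> good then \<exists>n. (x, f n x) \<in> \<Gamma> \<and> f n x \<in> A else x \<in> A} = T -` A \<inter> space \<mu>"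
    proof -
      have "(\<exists>n. (x, f n x) \<in> \<Gamma> \<and> f n x \<in> A) \<longleftrightarrow> T x \<in> A" if "x \<in> good" for x
        using T_G[OF that] T_eq[OF that] TR[of x] by (metis R_E)
      then show ?thesis by (auto simp: T_def)
    qed
    finally show "T -` A \<inter> space \<mu> \<in> sets \<mu>" .
  qed simp
  moreover have "U \<in> \<mu> \<rightarrow>\<^sub>M \<mu>"
  proof (rule measurableI)
    fix A assume [measurable]: "A \<in> sets \<mu>"
    have "{x \<in> space \<mu>. if x \<in> good then \<exists>n. (f n x, x) \<in> \<Gamma> \<and> f n x \<in> A else x \<in> A} \<in> sets \<mu>"
      by measurable
    also have "{x \<in> space \<mu>. if x \<in> good then \<exists>n. (f n x, x) \<in> \<Gamma> \<and> f n x \<in> A else x \<in> A} = U -` A \<inter> space \<mu>"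
    proof -
      have "(\<exists>n. (f n x, x) \<in> \<Gamma> \<and> f n x \<in> A) \<longleftrightarrow> U x \<in> A" if "x \<in> good" for x
        using U_G[OF that] U_eq[OF that] UR[of x] by (metis R_E)
      then show ?thesis by (auto simp: U_def)
    qed
    finally show "U -` A \<inter> space \<mu> \<in> sets \<mu>" .
  qed simp
  moreover have "AE x in \<mu>. (x, T x) \<in> \<Gamma>" using good_AE by eventually_elim (rule T_G)
  ultimately show ?thesis using TU UT TR by (intro that[of T U]) auto
qed

text \<open>Restrict the graph of \<open>T\<close> to pairs that end in \<open>A\<close>. Its domain
  is the preimage of \<open>A\<close> and its range is \<open>A\<close>, and both have the mass of
  the graph.\<close>

lemma meas_pres_of_R:
  assumes T: "\<And>x. T (U x) = x" "\<And>x. U (T x) = x" "T \<in> \<mu> \<rightarrow>\<^sub>M \<mu>" "U \<in> \<mu> \<rightarrow>\<^sub>M \<mu>"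
    and R: "\<And>x. (x, T x) \<in> R"
  shows "meas_pres \<mu> T"
proof -
  note [measurable] = T(3,4)
  have "distr \<mu> \<mu> T = \<mu>"
  proof (rule measure_eqI)
    fix A assume "A \<in> sets (distr \<mu> \<mu> T)"
    then have A [measurable]: "A \<in> sets \<mu>" by simp
    define \<Gamma> where "\<Gamma> = {(x, y). y = T x} \<inter> (UNIV \<times> A)"
    have U [measurable]: "UNIV \<in> sets \<mu>" using sets.top[of \<mu>] by simp
    have G: "\<Gamma> \<in> sets (\<mu> \<Otimes>\<^sub>M \<mu>)" "\<Gamma> \<subseteq> R"
      using graph_meas[OF T(3)] R unfolding \<Gamma>_def by (auto intro!: sets.Int pair_measureI)
    have sv: "single_valued \<Gamma>" "single_valued (\<Gamma>\<inverse>)"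
      using T(1,2) by (auto simp: single_valued_def \<Gamma>_def) (metis)
    have "Domain \<Gamma> = T -` A" by (auto simp: \<Gamma>_def)
    moreover have "Range \<Gamma> = A"
    proof -
      have "(U y, y) \<in> \<Gamma>" if "y \<in> A" for y using that T(1) by (simp add: \<Gamma>_def)
      then show ?thesis by (auto simp: \<Gamma>_def)
    qed
    ultimately have "emeasure \<mu> (T -` A) = emeasure \<mu> A"
      using emeasure_M_Domain[OF G sv(1)] emeasure_M_Range[OF G sv(2)] by simp
    then show "emeasure (distr \<mu> \<mu> T) A = emeasure \<mu> A" by (simp add: emeasure_distr)
  qed simp
  then show ?thesis using T(3) by (simp add: meas_pres_def)
qed

text \<open>Since \<open>T\<close> moves every point inside its class, \<open>T \<times> T\<close>
  maps \<open>R\<close> onto itself exactly.\<close>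

lemma full_group_I:
  assumes T: "\<And>x. T (U x) = x" "\<And>x. U (T x) = x" "T \<in> \<mu> \<rightarrow>\<^sub>M \<mu>" "U \<in> \<mu> \<rightarrow>\<^sub>M \<mu>"
    and R: "\<And>x. (x, T x) \<in> R"
  shows "T \<in> full_group \<mu> R"
proof -
  have "bij T" using T by (metis bijI')
  moreover have "the_inv_into UNIV T = U"
    using T by (metis UNIV_I \<open>bij T\<close> bij_is_inj ext the_inv_into_f_f)
  moreover have "map_prod T T ` R = R"
  proof -
    have "(T x, T y) \<in> R \<longleftrightarrow> (x, y) \<in> R" for x y using R[of x] R[of y] R_sym R_trans by blast
    then have "(U x, U y) \<in> R \<longleftrightarrow> (x, y) \<in> R" for x y by (metis T(1))
    then show ?thesis
      using map_prod_image_iff[OF T(1,2), of _ _ R] by (auto simp only: set_eq_iff split_paired_All)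
  qed
  ultimately show ?thesis
    using meas_pres_of_R[OF assms] assms by (simp add: full_group_def Aut_rel_def meas_aut_def)
qed


text \<open>The pattern that \<open>S\<close> induces on a list of translates is encoded by a list \<open>cs\<close> of colours.\<close>

definition pattern_set :: "'a rel \<Rightarrow> 'a set \<Rightarrow> nat list \<times> nat \<times> bool list list \<times> nat list \<Rightarrow> 'a set" where
  "pattern_set S Z = (\<lambda>(as, m, us, cs). {x. length us = length as \<and> length cs = length as \<and> distinct us \<and>
    (\<forall>i<length as. f (as ! i) x \<in> Z \<and> label m (f (as ! i) x) = us ! i) \<and>
    (\<forall>i<length as. \<forall>j<length as. (f (as ! i) x, f (as ! j) x) \<in> S \<longleftrightarrow> cs ! i = cs ! j)})"

lemma pattern_set_meas [measurable]:
  assumes [measurable]: "S \<in> sets (\<mu> \<Otimes>\<^sub>M \<mu>)" "Z \<in> sets \<mu>"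
  shows "pattern_set S Z c \<in> sets \<mu>"
proof -
  obtain as m us cs where c: "c = (as, m, us, cs)" by (cases c) auto
  have "{x \<in> space \<mu>. length us = length as \<and> length cs = length as \<and> distinct us \<and>
    (\<forall>i<length as. f (as ! i) x \<in> Z \<and> label m (f (as ! i) x) = us ! i) \<and>
    (\<forall>i<length as. \<forall>j<length as. (f (as ! i) x, f (as ! j) x) \<in> S \<longleftrightarrow> cs ! i = cs ! j)} \<in> sets \<mu>"
    by measurable
  then show ?thesis by (simp add: c pattern_set_def)
qed

text \<open>The list \<open>as\<close> consists of indices of maps that carry \<open>x\<close> to
  the given points, and \<open>m\<close> is a level at which the labels tell these finitely many
  points apart.\<close>

lemma pattern_set_ex:
  assumes ys: "distinct ys" "set ys \<subseteq> R `` {x} \<inter> Z" "length cs = length ys"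
    and S: "\<And>i j. i < length ys \<Longrightarrow> j < length ys \<Longrightarrow> (ys ! i, ys ! j) \<in> S \<longleftrightarrow> cs ! i = cs ! j"
  shows "\<exists>as m us. x \<in> pattern_set S Z (as, m, us, cs) \<and> map (\<lambda>a. f a x) as = ys"
proof -
  obtain m where m: "inj_on (label m) (set ys)" using label_separates by blast
  have "\<forall>y\<in>set ys. \<exists>a. y = f a x" using ys(2) by (auto simp: R_eq)
  then obtain g where g: "\<And>y. y \<in> set ys \<Longrightarrow> y = f (g y) x" by metis
  have *: "map (\<lambda>a. f a x) (map g ys) = ys" using g by (simp add: map_idI)
  then have nth: "f (map g ys ! i) x = ys ! i" if "i < length ys" for i
    using that by (metis length_map nth_map)
  have "distinct (map (label m) ys)" using m ys(1) by (simp add: distinct_map)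
  moreover have "ys ! i \<in> Z" if "i < length ys" for i using ys(2) that by force
  ultimately have "x \<in> pattern_set S Z (map g ys, m, map (label m) ys, cs)"
    using nth ys(3) S unfolding pattern_set_def by auto
  then show ?thesis using * by blast
qed

subsection \<open>Maximal partial isomorphisms\<close>

text \<open>The saturation of \<open>B\<close> is invariant and contains the non-null set
  \<open>B\<close>, so ergodicity makes it conull.\<close>

lemma ergodic_AE_visits:
  assumes erg: "ergodic_rel \<mu> R" and [measurable]: "B \<in> sets \<mu>" and pos: "emeasure \<mu> B > 0"
  shows "AE x in \<mu>. \<exists>k. f k x \<in> B"
proof -
  define A where "A = {x. \<exists>k. f k x \<in> B}"
  have "{x \<in> space \<mu>. \<exists>k. f k x \<in> B} \<in> sets \<mu>" by measurable
  then have Am: "A \<in> sets \<mu>" by (simp add: A_def)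
  have AR: "x \<in> A \<longleftrightarrow> (\<exists>y\<in>B. (x, y) \<in> R)" for x by (auto simp: A_def R_eq)
  have "y \<in> A" if x: "x \<in> A" and xy: "(x, y) \<in> R" for x y
  proof -
    obtain z where "z \<in> B" "(x, z) \<in> R" using x AR by blast
    then show ?thesis using R_trans[OF R_sym[OF xy]] AR by blast
  qed
  then have "R `` A = A" by (auto intro: ImageI[OF R_refl])
  then have "A \<in> null_sets \<mu> \<or> space \<mu> - A \<in> null_sets \<mu>"
    by (rule erg[unfolded ergodic_rel_def, rule_format, OF Am])
  moreover have "A \<notin> null_sets \<mu>"
  proof
    assume "A \<in> null_sets \<mu>"
    then have "AE x in \<mu>. x \<notin> A" by (rule AE_not_in)
    then have "AE x in \<mu>. x \<notin> B" by eventually_elim (metis AR R_refl)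
    then show False using pos not_AE_D by blast
  qed
  ultimately have "AE x in \<mu>. x \<in> A" by (auto dest: AE_not_in)
  then show ?thesis by (simp add: A_def)
qed

text \<open>Otherwise almost every class would contain no pair of a point in \<open>B\<close> and a
  translate of it in \<open>C\<close>. But almost every point of \<open>C\<close> has a translate in
  \<open>B\<close>, and some map of the action leads back.\<close>

lemma ergodic_meets:
  assumes erg: "ergodic_rel \<mu> R" and [measurable]: "B \<in> sets \<mu>" "C \<in> sets \<mu>"
    and pos: "emeasure \<mu> B > 0" "emeasure \<mu> C > 0"
  shows "\<exists>k. emeasure \<mu> (B \<inter> f k -` C) > 0"
proof (rule ccontr)
  assume neg: "\<nexists>k. emeasure \<mu> (B \<inter> f k -` C) > 0"
  have m: "B \<inter> f k -` C \<in> sets \<mu>" for k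
  proof -
    have "{x \<in> space \<mu>. x \<in> B \<and> f k x \<in> C} \<in> sets \<mu>" by measurable
    also have "{x \<in> space \<mu>. x \<in> B \<and> f k x \<in> C} = B \<inter> f k -` C" by auto
    finally show ?thesis .
  qed
  have "AE x in \<mu>. x \<notin> B \<inter> f k -` C" for k
    using neg m by (intro AE_not_in) (auto simp: null_sets_def)
  then have "AE x in \<mu>. \<forall>k. x \<notin> B \<inter> f k -` C" by (subst AE_all_countable) (rule allI)
  then have *: "AE x in \<mu>. \<forall>y. (x, y) \<in> R \<longrightarrow> (\<forall>k. y \<notin> B \<inter> f k -` C)" by (rule AE_saturate)
  have "AE x in \<mu>. x \<notin> C"
    using * ergodic_AE_visits[OF erg assms(2) pos(1)]
  proof eventually_elim
    case (elim x)
    from elim(2) obtain l where l: "f l x \<in> B" by blast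
    then obtain k where "x = f k (f l x)" using R_E[OF R_sym[OF R_f]] by metis
    then show ?case using elim(1) l by (metis IntI R_f vimageI2)
  qed
  then show False using pos(2) not_AE_D by blast
qed

text \<open>The colours \<open>cs\<close> are prescribed: any finite pattern occurs at almost every
  point of \<open>Z\<close>, and since the remaining data have countably many values, one choice of
  them works on a positive measure set.\<close>

lemma pattern_set_pos_of_infinite_index:
  assumes S: "subrel \<mu> R S" and ap: "aperiodic_rel \<mu> S" and ind: "everywhere_infinite_index \<mu> S R"
    and Z: "Z \<in> sets \<mu>" and pos: "emeasure \<mu> Z > 0"
  shows "\<exists>as m us. emeasure \<mu> (pattern_set S Z (as, m, us, cs)) > 0"
proof -
  have "\<exists>c. emeasure \<mu> ((\<lambda>(as, m, us). pattern_set S Z (as, m, us, cs)) c) > 0"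
  proof (rule countable_cover[OF pos])
    show "AE x in \<mu>. x \<in> Z \<longrightarrow> (\<exists>c. x \<in> (\<lambda>(as, m, us). pattern_set S Z (as, m, us, cs)) c)"
      using AE_ex_pattern[OF S ap ind Z, of cs]
    proof eventually_elim
      case (elim x)
      show ?case
      proof
        assume "x \<in> Z"
        with elim obtain ys where "length ys = length cs" "distinct ys" "set ys \<subseteq> R `` {x} \<inter> Z"
          "\<And>i j. i < length cs \<Longrightarrow> j < length cs \<Longrightarrow> (ys ! i, ys ! j) \<in> S \<longleftrightarrow> cs ! i = cs ! j" by blast
        then obtain as m us where "x \<in> pattern_set S Z (as, m, us, cs)"
          using pattern_set_ex[of ys x Z cs S] by auto
        then show "\<exists>c. x \<in> (\<lambda>(as, m, us). pattern_set S Z (as, m, us, cs)) c"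
          by (intro exI[of _ "(as, m, us)"]) simp
      qed
    qed
    show "(\<lambda>(as, m, us). pattern_set S Z (as, m, us, cs)) c \<in> sets \<mu>" for c
      using subrel_D(1)[OF S] Z by (cases c) auto
  qed
  then show ?thesis by auto
qed

text \<open>The list may name a point twice; on a \<open>pattern_set\<close> with the same list this
  is excluded, because the labels there are distinct.\<close>

definition list_class :: "'a rel \<Rightarrow> nat list \<Rightarrow> 'a set" where
  "list_class F as = {x. F `` {x} = (\<lambda>a. f a x) ` set as}"

lemma list_class_meas:
  assumes F [measurable]: "F \<in> sets (\<mu> \<Otimes>\<^sub>M \<mu>)" and "F \<subseteq> R"
  shows "list_class F as \<in> sets \<mu>"
proof -
  \<comment> \<open>Equality of two translates is expressed as membership in the diagonal, which is
    measurable as a graph.\<close>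
  have [measurable]: "{(x, y). y = x} \<in> sets (\<mu> \<Otimes>\<^sub>M \<mu>)" by (rule graph_meas) simp
  have "{x \<in> space \<mu>. (\<forall>a\<in>set as. (x, f a x) \<in> F) \<and>
      (\<forall>k. (x, f k x) \<in> F \<longrightarrow> (\<exists>a\<in>set as. (f a x, f k x) \<in> {(x, y). y = x}))} \<in> sets \<mu>" by measurable
  also have "{x \<in> space \<mu>. (\<forall>a\<in>set as. (x, f a x) \<in> F) \<and>
      (\<forall>k. (x, f k x) \<in> F \<longrightarrow> (\<exists>a\<in>set as. (f a x, f k x) \<in> {(x, y). y = x}))} = list_class F as"
  proof -
    have "F `` {x} = (\<lambda>a. f a x) ` set as \<longleftrightarrow>
      (\<forall>a\<in>set as. (x, f a x) \<in> F) \<and> (\<forall>k. (x, f k x) \<in> F \<longrightarrow> (\<exists>a\<in>set as. f k x = f a x))" for x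
    proof -
      have "y \<in> F `` {x} \<Longrightarrow> \<exists>k. y = f k x" for y using \<open>F \<subseteq> R\<close> by (auto simp: R_eq)
      then show ?thesis by (auto simp: set_eq_iff image_iff Bex_def Ball_def) metis+
    qed
    then show ?thesis by (auto simp: list_class_def)
  qed
  finally show ?thesis .
qed

text \<open>Here the colours are not prescribed but read off from \<open>S'\<close> on the finite
  class of a point. Lists, labels and colours together still take countably many values, so one code
  serves a positive measure set.\<close>

lemma pattern_set_pos_of_finite:
  assumes F [measurable]: "F \<in> sets (\<mu> \<Otimes>\<^sub>M \<mu>)" and FR: "F \<subseteq> R"
    and fin: "\<And>x. x \<in> Z \<Longrightarrow> finite (F `` {x})" and inv: "\<And>x. x \<in> Z \<Longrightarrow> F `` {x} \<subseteq> Z"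
    and S': "subrel \<mu> R S'"
    and Z [measurable]: "Z \<in> sets \<mu>" and pos: "emeasure \<mu> Z > 0"
  shows "\<exists>as m us cs. emeasure \<mu> (Z \<inter> list_class F as \<inter> pattern_set S' Z (as, m, us, cs)) > 0"
proof -
  define A where "A = (\<lambda>(as, m, us, cs). Z \<inter> list_class F as \<inter> pattern_set S' Z (as, m, us, cs))"
  note SD = subrel_D[OF S']
  have "\<exists>c. emeasure \<mu> (A c) > 0"
  proof (rule countable_cover[OF pos])
    have "\<exists>c. x \<in> A c" if x: "x \<in> Z" for x
    proof -
      obtain ys where ys: "set ys = F `` {x}" "distinct ys" using finite_distinct_list[OF fin[OF x]] by blast
      \<comment> \<open>The colour is the least index whose translate of \<open>x\<close> is
        \<open>S'\<close>-related to \<open>y\<close>: it depends only on the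
        \<open>S'\<close>-class of \<open>y\<close>, and it determines that class.\<close>
      define col where "col y = (LEAST k. (y, f k x) \<in> S')" for y
      have col: "(y, z) \<in> S' \<longleftrightarrow> col y = col z" if "y \<in> F `` {x}" "z \<in> F `` {x}" for y z
      proof
        assume "(y, z) \<in> S'"
        then have "(y, w) \<in> S' \<longleftrightarrow> (z, w) \<in> S'" for w using SD(3,4) by (meson symD transD)
        then show "col y = col z" by (simp add: col_def)
      next
        assume eq: "col y = col z"
        have "(w, f (col w) x) \<in> S'" if "w \<in> F `` {x}" for w
        proof -
          from that FR have "(x, w) \<in> R" by blast
          then obtain k where "w = f k x" by (rule R_E)
          then have "(w, f k x) \<in> S'" using SD(5) by simp
          then show ?thesis unfolding col_def by (rule LeastI)
        qed
        from this[OF that(1)] this[OF that(2)] show "(y, z) \<in> S'"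
          using SD(3,4) eq by (metis symD transD)
      qed
      have "\<exists>as m us. x \<in> pattern_set S' Z (as, m, us, map col ys) \<and> map (\<lambda>a. f a x) as = ys"
      proof (rule pattern_set_ex)
        show "set ys \<subseteq> R `` {x} \<inter> Z" using ys inv[OF x] FR by auto
        fix i j assume "i < length ys" "j < length ys"
        then show "(ys ! i, ys ! j) \<in> S' \<longleftrightarrow> map col ys ! i = map col ys ! j"
          using col[of "ys ! i" "ys ! j"] ys(1) by (metis nth_map nth_mem)
      qed (use ys in auto)
      then obtain as m us where c: "x \<in> pattern_set S' Z (as, m, us, map col ys)" "map (\<lambda>a. f a x) as = ys" by blast
      have "(\<lambda>a. f a x) ` set as = F `` {x}" using c(2) ys(1) by (metis image_set)
      then have "x \<in> A (as, m, us, map col ys)" using c x by (simp add: A_def list_class_def)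
      then show ?thesis by blast
    qed
    then show "AE x in \<mu>. x \<in> Z \<longrightarrow> (\<exists>c. x \<in> A c)" by (intro AE_I2 impI)
    show "A c \<in> sets \<mu>" for c
    proof -
      note [measurable] = list_class_meas[OF F FR] SD(1)
      show ?thesis by (cases c) (auto simp: A_def)
    qed
  qed
  then show ?thesis by (auto simp: A_def)
qed

text \<open>The \<open>i\<close>-th listed point of the class of \<open>x\<close> is sent to the
  \<open>i\<close>-th listed translate of \<open>f k x\<close>. Distinct labels recover
  \<open>i\<close> from a point on either side, and injectivity of the maps then recovers
  \<open>x\<close>; this gives injectivity. The domain is \<open>F\<close>-invariant because
  \<open>as\<close> lists a full class, and the common colours \<open>cs\<close> on both sides turn
  \<open>S'\<close> into \<open>S\<close>.\<close>

lemma glue_piece: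
  assumes n: "length as = n" "length bs = n" "length us = n" "length vs = n" "distinct us" "distinct vs"
    and F: "F \<subseteq> R" "sym F" "trans F" "\<And>x. x \<in> B \<Longrightarrow> (x, x) \<in> F"
    and B [measurable]: "B \<in> sets \<mu>" and cls: "B \<subseteq> list_class F as"
    and a: "B \<subseteq> pattern_set S' Z (as, m, us, cs)" and b: "f k ` B \<subseteq> pattern_set S Z' (bs, m', vs, cs)"
  defines "\<Delta> \<equiv> {(f (as ! i) x, f (bs ! i) (f k x)) | i x. i < n \<and> x \<in> B}"
  shows "partial_iso F S' S \<Delta>" "\<Delta> \<in> sets (\<mu> \<Otimes>\<^sub>M \<mu>)" "\<Delta> \<subseteq> R" "Domain \<Delta> \<subseteq> Z" "Range \<Delta> \<subseteq> Z'"
    "\<And>x. x \<in> B \<Longrightarrow> x \<in> Domain \<Delta>"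
proof -
  have cls': "F `` {x} = {f (as ! i) x | i. i < n}" if "x \<in> B" for x
  proof -
    have "F `` {x} = (\<lambda>a. f a x) ` set as" using that cls by (auto simp: list_class_def)
    then show ?thesis using n(1) by (auto simp: set_conv_nth)
  qed
  have a': "f (as ! i) x \<in> Z" "label m (f (as ! i) x) = us ! i"
    "j < n \<Longrightarrow> (f (as ! i) x, f (as ! j) x) \<in> S' \<longleftrightarrow> cs ! i = cs ! j" if "x \<in> B" "i < n" for x i j
    using a that n(1) by (auto simp: pattern_set_def)
  have b': "f (bs ! i) (f k x) \<in> Z'" "label m' (f (bs ! i) (f k x)) = vs ! i"
    "j < n \<Longrightarrow> (f (bs ! i) (f k x), f (bs ! j) (f k x)) \<in> S \<longleftrightarrow> cs ! i = cs ! j" if "x \<in> B" "i < n" for x i j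
    using b that n(2) by (auto simp: pattern_set_def)
  have inj_a: "i = j \<and> x = y" if "f (as ! i) x = f (as ! j) y" "x \<in> B" "y \<in> B" "i < n" "j < n" for i j x y
  proof -
    have "us ! i = us ! j" using a'(2)[of x i] a'(2)[of y j] that by simp
    then have "i = j" using n that by (simp add: nth_eq_iff_index_eq)
    then show ?thesis using that f_inj by blast
  qed
  have inj_b: "i = j \<and> x = y" if "f (bs ! i) (f k x) = f (bs ! j) (f k y)" "x \<in> B" "y \<in> B" "i < n" "j < n" for i j x y
  proof -
    have "vs ! i = vs ! j" using b'(2)[of x i] b'(2)[of y j] that by simp
    then have "i = j" using n that by (simp add: nth_eq_iff_index_eq)
    then show ?thesis using that f_inj by blast
  qed
  show BD: "x \<in> Domain \<Delta>" if x: "x \<in> B" for x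
  proof -
    have "x \<in> F `` {x}" using F(4)[OF x] by simp
    then obtain i where "i < n" "x = f (as ! i) x" using cls'[OF x] by auto
    then show ?thesis using x unfolding \<Delta>_def by blast
  qed
  show "Domain \<Delta> \<subseteq> Z" "Range \<Delta> \<subseteq> Z'" using a'(1) b'(1) unfolding \<Delta>_def by blast+
  show "\<Delta> \<subseteq> R"
  proof -
    have "(f (as ! i) x, f (bs ! i) (f k x)) \<in> R" for i x
      using R_f R_sym R_trans by meson
    then show ?thesis unfolding \<Delta>_def by blast
  qed
  show "\<Delta> \<in> sets (\<mu> \<Otimes>\<^sub>M \<mu>)"
  proof -
    define h where "h i y = f (bs ! i) (f k (finv (as ! i) y))" for i y
    have h: "h i \<in> \<mu> \<rightarrow>\<^sub>M \<mu>" for i unfolding h_def by measurable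
    have "{y \<in> space \<mu>. finv (as ! i) y \<in> B} \<in> sets \<mu>" for i by measurable
    then have "({(y, z). z = h i y} \<inter> ({y. finv (as ! i) y \<in> B} \<times> space \<mu>)) \<in> sets (\<mu> \<Otimes>\<^sub>M \<mu>)" for i
      by (intro sets.Int graph_meas h pair_measureI sets.top) simp
    then have "(\<Union>i<n. {(y, z). z = h i y} \<inter> ({y. finv (as ! i) y \<in> B} \<times> space \<mu>)) \<in> sets (\<mu> \<Otimes>\<^sub>M \<mu>)"
      by blast
    also have "(\<Union>i<n. {(y, z). z = h i y} \<inter> ({y. finv (as ! i) y \<in> B} \<times> space \<mu>)) = \<Delta>"
      unfolding \<Delta>_def h_def by (auto simp: finv_eq) (metis f_finv finv_f)
    finally show ?thesis .
  qed
  have D_E: "\<exists>i x. i < n \<and> x \<in> B \<and> y = f (as ! i) x \<and> z = f (bs ! i) (f k x)" if "(y, z) \<in> \<Delta>" for y z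
    using that unfolding \<Delta>_def by blast
  have F_E: "\<exists>j<n. z = f (as ! j) x" if "(f (as ! i) x, z) \<in> F" "x \<in> B" "i < n" for i x z
  proof -
    have "(x, f (as ! i) x) \<in> F" using cls'[OF that(2)] that(3) by blast
    then have "z \<in> F `` {x}" using that(1) F(3) by (meson Image_singleton_iff transD)
    then show ?thesis using cls'[OF that(2)] by blast
  qed
  show "partial_iso F S' S \<Delta>"
  proof (rule partial_isoI)
    show "y = z" if "(x, y) \<in> \<Delta>" "(x, z) \<in> \<Delta>" for x y z
      using D_E[OF that(1)] D_E[OF that(2)] inj_a by metis
    show "x = y" if "(x, z) \<in> \<Delta>" "(y, z) \<in> \<Delta>" for x y z
      using D_E[OF that(1)] D_E[OF that(2)] inj_b by metis
    show "y \<in> Domain \<Delta>" if xy: "(x, y) \<in> F" "x \<in> Domain \<Delta>" for x y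
    proof -
      obtain i w where w: "i < n" "w \<in> B" "x = f (as ! i) w" using xy(2) D_E by blast
      then obtain j where "j < n" "y = f (as ! j) w" using F_E xy(1) by blast
      then show ?thesis using w(2) unfolding \<Delta>_def by blast
    qed
    fix x x' y y' assume xy: "(x, x') \<in> \<Delta>" "(y, y') \<in> \<Delta>" "(x, y) \<in> F"
    obtain i w where w: "i < n" "w \<in> B" "x = f (as ! i) w" "x' = f (bs ! i) (f k w)" using D_E[OF xy(1)] by blast
    obtain j v where v: "j < n" "v \<in> B" "y = f (as ! j) v" "y' = f (bs ! j) (f k v)" using D_E[OF xy(2)] by blast
    \<comment> \<open>The point \<open>y\<close> is also a listed translate of the base point
      \<open>w\<close> of \<open>x\<close>; injectivity identifies this description with the one by
      \<open>v\<close>, so both pairs come from one base point, where the colours apply.\<close>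
    obtain l where l: "l < n" "y = f (as ! l) w" using F_E xy(3) w by blast
    then have eq: "f (as ! l) w = f (as ! j) v" using v(3) by (simp only:)
    have "l = j" "w = v" using inj_a[OF eq w(2) v(2) l(1) v(1)] by blast+
    with a'(3)[OF w(2,1) v(1)] b'(3)[OF w(2,1) v(1)] show "((x', y') \<in> S) = ((x, y) \<in> S')"
      unfolding w(3,4) v(3,4) by (simp only:)
  qed
qed


text \<open>A coloured pattern of \<open>S'\<close> is found on the classes of \<open>F\<close>
  outside the domain, and the same colours are realized by \<open>S\<close> outside the range.
  Ergodicity yields one map \<open>f k\<close> taking a positive measure part \<open>B\<close> of
  the first set into the second, and the piece glued along \<open>B\<close> enlarges the
  domain.\<close>

lemma partial_iso_extend:
  assumes erg: "ergodic_rel \<mu> R" and S: "subrel \<mu> R S" and ap: "aperiodic_rel \<mu> S"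
    and ind: "everywhere_infinite_index \<mu> S R" and S': "subrel \<mu> R S'"
    and F [measurable]: "F \<in> sets (\<mu> \<Otimes>\<^sub>M \<mu>)" and FR: "F \<subseteq> R"
    and X0 [measurable]: "X\<^sub>0 \<in> sets \<mu>" and eqF: "equiv X\<^sub>0 F" and fin: "\<And>x. x \<in> X\<^sub>0 \<Longrightarrow> finite (F `` {x})"
    and G [measurable]: "\<Gamma> \<in> sets (\<mu> \<Otimes>\<^sub>M \<mu>)" and GR: "\<Gamma> \<subseteq> R" and iso: "partial_iso F S' S \<Gamma>"
    and pos: "emeasure \<mu> (X\<^sub>0 - Domain \<Gamma>) > 0"
  shows "\<exists>\<Gamma>'. \<Gamma>' \<in> sets (\<mu> \<Otimes>\<^sub>M \<mu>) \<and> \<Gamma>' \<subseteq> R \<and> partial_iso F S' S \<Gamma>' \<and> \<Gamma> \<subseteq> \<Gamma>' \<and>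
    measure \<mu> (Domain \<Gamma>) < measure \<mu> (Domain \<Gamma>')"
proof -
  have symF: "sym F" and transF: "trans F" and reflF: "\<And>x. x \<in> X\<^sub>0 \<Longrightarrow> (x, x) \<in> F" and FX: "F \<subseteq> X\<^sub>0 \<times> X\<^sub>0"
    using eqF by (auto simp: equiv_def refl_on_def)
  have sv: "single_valued \<Gamma>" "single_valued (\<Gamma>\<inverse>)" using iso by (auto simp: partial_iso_def)
  note isoD = partial_isoD[OF iso]
  define Z where "Z = X\<^sub>0 - Domain \<Gamma>"
  have Dm [measurable]: "Domain \<Gamma> \<in> sets \<mu>" "Range \<Gamma> \<in> sets \<mu>"
    using Domain_meas[OF G GR] Range_meas[OF G GR] .
  have Zm [measurable]: "Z \<in> sets \<mu>" unfolding Z_def by measurable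
  define Z' where "Z' = space \<mu> - Range \<Gamma>"
  have Z'm [measurable]: "Z' \<in> sets \<mu>" unfolding Z'_def by measurable
  have eqDR: "measure \<mu> (Range \<Gamma>) = measure \<mu> (Domain \<Gamma>)"
    using emeasure_M_Domain[OF G GR sv(1)] emeasure_M_Range[OF G GR sv(2)] by (simp add: measure_def)
  have un: "measure \<mu> (Domain \<Gamma> \<union> B) = measure \<mu> (Domain \<Gamma>) + measure \<mu> B" if "B \<in> sets \<mu>" "B \<subseteq> Z" for B
    using that by (intro finite_measure_Union) (auto simp: Z_def)
  have "measure \<mu> (Domain \<Gamma>) + measure \<mu> Z \<le> 1" using un[of Z] prob_le_1[of "Domain \<Gamma> \<union> Z"] by simp
  moreover have "measure \<mu> Z > 0" using pos by (simp add: Z_def emeasure_eq_measure)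
  moreover have "measure \<mu> Z' = 1 - measure \<mu> (Range \<Gamma>)" unfolding Z'_def by (rule prob_compl) simp
  \<comment> \<open>Domain and range have equal measure, so room left outside the domain means room
    left outside the range.\<close>
  ultimately have pos': "emeasure \<mu> Z' > 0" using eqDR by (simp add: emeasure_eq_measure)
  have "\<exists>as m us cs. emeasure \<mu> (Z \<inter> list_class F as \<inter> pattern_set S' Z (as, m, us, cs)) > 0"
  proof (rule pattern_set_pos_of_finite[OF F FR _ _ S' Zm])
    fix x assume x: "x \<in> Z"
    then show "finite (F `` {x})" using fin by (simp add: Z_def)
    \<comment> \<open>The complement of the domain is \<open>F\<close>-invariant because the domain
      is and \<open>F\<close> is symmetric.\<close>
    show "F `` {x} \<subseteq> Z"
    proof
      fix y assume "y \<in> F `` {x}"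
      then have "(x, y) \<in> F" "(y, x) \<in> F" using symF by (auto dest: symD)
      then show "y \<in> Z" using isoD(3)[of y x] x FX by (auto simp: Z_def)
    qed
  qed (use pos in \<open>simp add: Z_def\<close>)
  then obtain as m us cs where B0: "emeasure \<mu> (Z \<inter> list_class F as \<inter> pattern_set S' Z (as, m, us, cs)) > 0" by blast
  obtain bs m' vs where C: "emeasure \<mu> (pattern_set S Z' (bs, m', vs, cs)) > 0"
    using pattern_set_pos_of_infinite_index[OF S ap ind Z'm pos', of cs] by blast
  note [measurable] = list_class_meas[OF F FR] subrel_D(1)[OF S] subrel_D(1)[OF S']
  obtain k where k: "emeasure \<mu> (Z \<inter> list_class F as \<inter> pattern_set S' Z (as, m, us, cs) \<inter> f k -` pattern_set S Z' (bs, m', vs, cs)) > 0"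
    using ergodic_meets[OF erg _ _ B0 C] by auto
  define B where "B = Z \<inter> list_class F as \<inter> pattern_set S' Z (as, m, us, cs) \<inter> f k -` pattern_set S Z' (bs, m', vs, cs)"
  have "{x \<in> space \<mu>. f k x \<in> pattern_set S Z' (bs, m', vs, cs)} \<in> sets \<mu>" by measurable
  then have Bm [measurable]: "B \<in> sets \<mu>" unfolding B_def vimage_def by simp
  have Bpos: "measure \<mu> B > 0" using k by (simp add: B_def emeasure_eq_measure)
  have BZ: "B \<subseteq> Z" unfolding B_def by blast
  from Bpos have "B \<noteq> {}" by auto
  then obtain x where "x \<in> pattern_set S' Z (as, m, us, cs)" "f k x \<in> pattern_set S Z' (bs, m', vs, cs)"
    unfolding B_def by blast
  then have len: "length us = length as" "length cs = length as" "distinct us"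
    "length vs = length bs" "length cs = length bs" "distinct vs" by (auto simp: pattern_set_def)
  define \<Delta> where "\<Delta> = {(f (as ! i) x, f (bs ! i) (f k x)) | i x. i < length as \<and> x \<in> B}"
  have \<Delta>: "partial_iso F S' S \<Delta>" "\<Delta> \<in> sets (\<mu> \<Otimes>\<^sub>M \<mu>)" "\<Delta> \<subseteq> R" "Domain \<Delta> \<subseteq> Z" "Range \<Delta> \<subseteq> Z'"
    "\<And>x. x \<in> B \<Longrightarrow> x \<in> Domain \<Delta>"
    unfolding \<Delta>_def
    by (rule glue_piece[where as = as and bs = bs and us = us and vs = vs and m = m and m' = m' and cs = cs and Z = Z and Z' = Z']; (use len FR symF transF reflF in \<open>auto simp: B_def Z_def\<close>)?)+
  have "measure \<mu> (Domain \<Gamma>) < measure \<mu> (Domain \<Gamma> \<union> B)" using un[OF Bm BZ] Bpos by simp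
  also have "\<dots> \<le> measure \<mu> (Domain (\<Gamma> \<union> \<Delta>))"
  proof (rule finite_measure_mono)
    show "Domain \<Gamma> \<union> B \<subseteq> Domain (\<Gamma> \<union> \<Delta>)" using \<Delta>(6) by blast
    show "Domain (\<Gamma> \<union> \<Delta>) \<in> sets \<mu>"
      by (rule Domain_meas[OF sets.Un[OF G \<Delta>(2)] Un_least[OF GR \<Delta>(3)]])
  qed
  finally have "measure \<mu> (Domain \<Gamma>) < measure \<mu> (Domain (\<Gamma> \<union> \<Delta>))" .
  moreover have "partial_iso F S' S (\<Gamma> \<union> \<Delta>)"
    by (rule partial_iso_Un[OF iso \<Delta>(1) symF]) (use \<Delta>(4,5) in \<open>auto simp: Z_def Z'_def\<close>)
  ultimately show ?thesis using \<Delta> GR G by (intro exI[of _ "\<Gamma> \<union> \<Delta>"]) auto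
qed

text \<open>Exhaustion over partial isomorphisms, ordered by inclusion and valued by the measure of
  the domain, gives one that cannot be extended; its domain is therefore conull, and it completes to
  a bijection \<open>V\<close>.\<close>

lemma full_group_realizes:
  assumes erg: "ergodic_rel \<mu> R" and S: "subrel \<mu> R S" and ap: "aperiodic_rel \<mu> S"
    and ind: "everywhere_infinite_index \<mu> S R" and S': "subrel \<mu> R S'"
    and F: "F \<in> sets (\<mu> \<Otimes>\<^sub>M \<mu>)" and FR: "F \<subseteq> R"
    and X0: "X\<^sub>0 \<in> sets \<mu>" and co: "AE x in \<mu>. x \<in> X\<^sub>0"
    and eqF: "equiv X\<^sub>0 F" and fin: "\<And>x. x \<in> X\<^sub>0 \<Longrightarrow> finite (F `` {x})"
  shows "\<exists>T\<in>full_group \<mu> R. AE x in \<mu>. \<forall>y. (x, y) \<in> F \<longrightarrow> ((x, y) \<in> map_prod T T ` S \<longleftrightarrow> (x, y) \<in> S')"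
proof -
  define \<C> where "\<C> = {\<Gamma>. \<Gamma> \<in> sets (\<mu> \<Otimes>\<^sub>M \<mu>) \<and> \<Gamma> \<subseteq> R \<and> partial_iso F S' S \<Gamma>}"
  obtain \<Gamma> where G: "\<Gamma> \<in> \<C>"
    and max: "\<And>\<Gamma>'. \<Gamma>' \<in> \<C> \<Longrightarrow> \<Gamma> \<subseteq> \<Gamma>' \<Longrightarrow> measure \<mu> (Domain \<Gamma>') \<le> measure \<mu> (Domain \<Gamma>)"
  proof (rule countable_exhaustion[of "{}" \<C> "\<lambda>\<Gamma>. measure \<mu> (Domain \<Gamma>)" 1])
    show "{} \<in> \<C>" by (auto simp: \<C>_def intro!: partial_isoI)
    show "measure \<mu> (Domain A) \<le> measure \<mu> (Domain A')" if "A \<in> \<C>" "A' \<in> \<C>" "A \<subseteq> A'" for A A'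
      using that by (intro finite_measure_mono) (auto simp: \<C>_def intro!: Domain_meas)
    show "(\<Union>n. A n) \<in> \<C>" if "incseq A" "\<And>n. A n \<in> \<C>" for A :: "nat \<Rightarrow> 'a rel"
      using that partial_iso_Union[OF that(1), of F S' S] by (auto simp: \<C>_def)
  qed auto
  then have G': "\<Gamma> \<in> sets (\<mu> \<Otimes>\<^sub>M \<mu>)" "\<Gamma> \<subseteq> R" "partial_iso F S' S \<Gamma>" by (auto simp: \<C>_def)
  note isoD = partial_isoD[OF G'(3)]
  have sv: "single_valued \<Gamma>" "single_valued (\<Gamma>\<inverse>)" using G'(3) by (auto simp: partial_iso_def)
  have "\<not> emeasure \<mu> (X\<^sub>0 - Domain \<Gamma>) > 0"
  proof
    assume "emeasure \<mu> (X\<^sub>0 - Domain \<Gamma>) > 0"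
    from partial_iso_extend[OF erg S ap ind S' F FR X0 eqF fin G' this]
    obtain \<Gamma>' where "\<Gamma>' \<in> \<C>" "\<Gamma> \<subseteq> \<Gamma>'" "measure \<mu> (Domain \<Gamma>) < measure \<mu> (Domain \<Gamma>')"
      unfolding \<C>_def by blast
    then show False using max[of \<Gamma>'] by simp
  qed
  then have "AE x in \<mu>. x \<notin> X\<^sub>0 - Domain \<Gamma>"
    using X0 Domain_meas[OF G'(1,2)] by (intro AE_not_in) (auto simp: null_sets_def)
  with co have dom: "AE x in \<mu>. x \<in> Domain \<Gamma>" by eventually_elim auto
  \<comment> \<open>The group element sought is the inverse \<open>T\<close> of the completed map:
    \<open>(x, y)\<close> lies in the image of \<open>S\<close> under \<open>T \<times> T\<close>
    iff \<open>(V x, V y)\<close> lies in \<open>S\<close>, and this is what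
    \<open>partial_iso\<close> controls.\<close>
  obtain V T where V: "\<And>x. V (T x) = x" "\<And>x. T (V x) = x" "V \<in> \<mu> \<rightarrow>\<^sub>M \<mu>" "T \<in> \<mu> \<rightarrow>\<^sub>M \<mu>"
    "\<And>x. (x, V x) \<in> R" "AE x in \<mu>. (x, V x) \<in> \<Gamma>"
    by (rule full_iso_of_partial[OF G'(1,2) sv dom]) (rule that, assumption+)
  have "(x, T x) \<in> R" for x using R_sym[OF V(5)[of "T x"]] by (simp add: V(1))
  then have T: "T \<in> full_group \<mu> R" by (intro full_group_I[OF V(2,1,4,3)])
  have "AE x in \<mu>. \<forall>y. (x, y) \<in> R \<longrightarrow> (y, V y) \<in> \<Gamma>" by (rule AE_saturate[OF V(6)])
  then have "AE x in \<mu>. \<forall>y. (x, y) \<in> F \<longrightarrow> ((x, y) \<in> map_prod T T ` S \<longleftrightarrow> (x, y) \<in> S')"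
  proof eventually_elim
    case (elim x)
    then have "(x, V x) \<in> \<Gamma>" by simp
    show ?case
    proof (intro allI impI)
      fix y assume xy: "(x, y) \<in> F"
      then have "(y, V y) \<in> \<Gamma>" using elim FR by blast
      then show "(x, y) \<in> map_prod T T ` S \<longleftrightarrow> (x, y) \<in> S'"
        using isoD(4)[OF \<open>(x, V x) \<in> \<Gamma>\<close> _ xy] by (simp only: map_prod_image_iff[OF V(2,1)])
    qed
  qed
  then show ?thesis using T by blast
qed

subsection \<open>Density of orbits\<close>

lemma meas_autD:
  assumes "T \<in> meas_aut \<mu>"
  obtains U where "\<And>x. T (U x) = x" "\<And>x. U (T x) = x" "T \<in> \<mu> \<rightarrow>\<^sub>M \<mu>" "U \<in> \<mu> \<rightarrow>\<^sub>M \<mu>"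
    "\<And>A. A \<in> sets \<mu> \<Longrightarrow> emeasure \<mu> (U -` A) = emeasure \<mu> A"
proof -
  have bij: "bij T" and mp: "meas_pres \<mu> T" and U: "the_inv_into UNIV T \<in> \<mu> \<rightarrow>\<^sub>M \<mu>"
    using assms by (auto simp: meas_aut_def)
  let ?U = "the_inv_into UNIV T"
  have TU: "T (?U x) = x" for x using bij f_the_inv_into_f_bij_betw[of T UNIV UNIV x] by simp
  have UT: "?U (T x) = x" for x using bij by (simp add: bij_is_inj the_inv_f_f)
  have T: "T \<in> \<mu> \<rightarrow>\<^sub>M \<mu>" "distr \<mu> \<mu> T = \<mu>" using mp by (auto simp: meas_pres_def)
  have "emeasure \<mu> (?U -` A) = emeasure \<mu> A" if "A \<in> sets \<mu>" for A
  proof -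
    have m: "?U -` A \<in> sets \<mu>" using measurable_sets[OF U that] by simp
    have "emeasure \<mu> (?U -` A) = emeasure (distr \<mu> \<mu> T) (?U -` A)" by (simp only: T(2))
    also have "\<dots> = emeasure \<mu> (T -` (?U -` A) \<inter> space \<mu>)" by (rule emeasure_distr[OF T(1) m])
    also have "T -` (?U -` A) \<inter> space \<mu> = A" by (auto simp: UT)
    finally show ?thesis .
  qed
  then show ?thesis using that[of ?U] TU UT T(1) U by blast
qed

lemma subrel_image:
  assumes S: "subrel \<mu> R S" and T: "T \<in> meas_aut \<mu>"
  shows "subrel \<mu> R (map_prod T T ` S \<inter> R)"
proof -
  obtain U where U: "\<And>x. T (U x) = x" "\<And>x. U (T x) = x" "U \<in> \<mu> \<rightarrow>\<^sub>M \<mu>"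
    by (rule meas_autD[OF T]) (rule that, assumption+)
  note [measurable] = U(3) subrel_D(1)[OF S]
  have "{p \<in> space (\<mu> \<Otimes>\<^sub>M \<mu>). (U (fst p), U (snd p)) \<in> S} \<in> sets (\<mu> \<Otimes>\<^sub>M \<mu>)" by measurable
  also have "{p \<in> space (\<mu> \<Otimes>\<^sub>M \<mu>). (U (fst p), U (snd p)) \<in> S} = map_prod T T ` S"
    by (simp add: set_eq_iff space_pair_measure map_prod_image_iff[OF U(1,2)])
  finally have m: "map_prod T T ` S \<inter> R \<in> sets (\<mu> \<Otimes>\<^sub>M \<mu>)" by simp
  have "equiv UNIV (map_prod T T ` S \<inter> R)"
  proof (rule equivI)
    show "refl_on UNIV (map_prod T T ` S \<inter> R)"
      using subrel_D(5)[OF S] by (auto simp: refl_on_def map_prod_image_iff[OF U(1,2)])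
    show "sym (map_prod T T ` S \<inter> R)"
      using subrel_D(3)[OF S] by (auto simp: sym_def map_prod_image_iff[OF U(1,2)] intro: R_sym)
    show "trans (map_prod T T ` S \<inter> R)"
    proof (rule transI)
      fix x y z assume "(x, y) \<in> map_prod T T ` S \<inter> R" "(y, z) \<in> map_prod T T ` S \<inter> R"
      then show "(x, z) \<in> map_prod T T ` S \<inter> R"
        using subrel_D(4)[OF S] R_trans[of x y z] unfolding Int_iff map_prod_image_iff[OF U(1,2)]
        by (meson transD)
    qed
  qed auto
  then show ?thesis using m by (simp add: subrel_def)
qed

lemma rel_orbit_subset_Sub:
  assumes "subrel \<mu> R S" "H \<subseteq> meas_aut \<mu>"
  shows "rel_orbit \<mu> R H S \<subseteq> Sub \<mu> R"
  using subrel_image[OF assms(1)] assms(2) by (auto simp: rel_orbit_def Sub_def)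

lemma in_closure_orbit_iff:
  assumes m: "finite_equiv_measure m M" and S: "subrel \<mu> R S" and H: "H \<subseteq> meas_aut \<mu>" and S': "subrel \<mu> R S'"
  shows "MAlg_class M S' \<in> Sub_topology \<mu> R m closure_of rel_orbit \<mu> R H S \<longleftrightarrow>
    (\<forall>r>0. \<exists>T\<in>H. measure m (sym_diff S' (map_prod T T ` S \<inter> R)) < r)"
proof -
  interpret Metric_space "MAlg M" "MAlg_dist m" by (rule MAlg_metric[OF m])
  have sM: "A \<in> sets M" if "subrel \<mu> R A" for A using that by (auto simp: subrel_def sets_M)
  have cM: "MAlg_class M A \<in> MAlg M" if "subrel \<mu> R A" for A
    using sM[OF that] by (auto simp: MAlg_def MAlg_class_def quotient_def)
  have "Sub \<mu> R \<inter> rel_orbit \<mu> R H S = rel_orbit \<mu> R H S"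
    using rel_orbit_subset_Sub[OF S H] by blast
  then have "MAlg_class M S' \<in> Sub_topology \<mu> R m closure_of rel_orbit \<mu> R H S \<longleftrightarrow>
      (\<forall>r>0. \<exists>y\<in>rel_orbit \<mu> R H S. y \<in> mball (MAlg_class M S') r)"
    using S' cM[OF S'] unfolding Sub_topology_def MAlg_topology_def closure_of_subtopology metric_closure_of
    by (auto simp: Sub_def)
  also have "\<dots> \<longleftrightarrow> (\<forall>r>0. \<exists>T\<in>H. measure m (sym_diff S' (map_prod T T ` S \<inter> R)) < r)"
  proof -
    have "MAlg_class M (map_prod T T ` S \<inter> R) \<in> mball (MAlg_class M S') r \<longleftrightarrow>
        measure m (sym_diff S' (map_prod T T ` S \<inter> R)) < r" if "T \<in> H" for T r
    proof -
      have s: "subrel \<mu> R (map_prod T T ` S \<inter> R)" using subrel_image[OF S] that H by auto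
      show ?thesis unfolding in_mball using cM[OF S'] cM[OF s] MAlg_dist_class[OF m sM[OF S'] sM[OF s]] by simp
    qed
    then have "(\<exists>y\<in>rel_orbit \<mu> R H S. y \<in> mball (MAlg_class M S') r) \<longleftrightarrow>
        (\<exists>T\<in>H. measure m (sym_diff S' (map_prod T T ` S \<inter> R)) < r)" for r
      unfolding rel_orbit_def by (simp del: in_mball)
    then show ?thesis by (simp only:)
  qed
  finally show ?thesis .
qed

text \<open>From here on density is used only in this form, as approximation of representatives in
  the measure \<open>m\<close>.\<close>

lemma closure_eq_Sub_iff:
  assumes m: "finite_equiv_measure m M" and S: "subrel \<mu> R S" and H: "H \<subseteq> meas_aut \<mu>"
  shows "Sub_topology \<mu> R m closure_of rel_orbit \<mu> R H S = Sub \<mu> R \<longleftrightarrow>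
    (\<forall>S'. subrel \<mu> R S' \<longrightarrow> (\<forall>r>0. \<exists>T\<in>H. measure m (sym_diff S' (map_prod T T ` S \<inter> R)) < r))"
proof -
  have "Sub_topology \<mu> R m closure_of rel_orbit \<mu> R H S \<subseteq> Sub \<mu> R"
    unfolding Sub_topology_def closure_of_subtopology by blast
  then have "Sub_topology \<mu> R m closure_of rel_orbit \<mu> R H S = Sub \<mu> R \<longleftrightarrow>
      (\<forall>S'. subrel \<mu> R S' \<longrightarrow> MAlg_class M S' \<in> Sub_topology \<mu> R m closure_of rel_orbit \<mu> R H S)"
    unfolding Sub_def by blast
  then show ?thesis using in_closure_orbit_iff[OF m S H] by simp
qed

lemma full_group_subset: "full_group \<mu> R \<subseteq> Aut_rel \<mu> R" "Aut_rel \<mu> R \<subseteq> meas_aut \<mu>"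
  by (auto simp: full_group_def Aut_rel_def)

lemma hyperfiniteE:
  assumes "hyperfinite_rel \<mu> R"
  obtains X\<^sub>0 F where "X\<^sub>0 \<in> sets \<mu>" "AE x in \<mu>. x \<in> X\<^sub>0" "incseq F" "(\<Union>n. F n) = R \<inter> (X\<^sub>0 \<times> X\<^sub>0)"
    "\<And>n :: nat. F n \<in> sets (\<mu> \<Otimes>\<^sub>M \<mu>)" "\<And>n. equiv X\<^sub>0 (F n)" "\<And>n x. x \<in> X\<^sub>0 \<Longrightarrow> finite (F n `` {x})"
proof -
  from assms obtain X\<^sub>0 where X0: "X\<^sub>0 \<in> sets \<mu>" "space \<mu> - X\<^sub>0 \<in> null_sets \<mu>" and
    "\<exists>F :: nat \<Rightarrow> 'a rel. incseq F \<and> (\<Union>n. F n) = R \<inter> (X\<^sub>0 \<times> X\<^sub>0) \<and>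
       (\<forall>n. F n \<in> sets (\<mu> \<Otimes>\<^sub>M \<mu>) \<and> equiv X\<^sub>0 (F n) \<and> (\<forall>x\<in>X\<^sub>0. finite (F n `` {x})))"
    unfolding hyperfinite_rel_def by (elim bexE conjE) (rule that)
  then obtain F :: "nat \<Rightarrow> 'a rel" where F: "incseq F" "(\<Union>n. F n) = R \<inter> (X\<^sub>0 \<times> X\<^sub>0)"
       "\<forall>n. F n \<in> sets (\<mu> \<Otimes>\<^sub>M \<mu>) \<and> equiv X\<^sub>0 (F n) \<and> (\<forall>x\<in>X\<^sub>0. finite (F n `` {x}))"
    by (elim exE conjE) (rule that)
  have "AE x in \<mu>. x \<in> X\<^sub>0" using AE_not_in[OF X0(2)] by simp
  then show ?thesis using X0(1) F by (intro that[of X\<^sub>0 F]) auto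
qed

text \<open>As \<open>m\<close> is finite and the sets \<open>R - F n\<close> decrease to a null
  set, some \<open>F n\<close> carries all but less than \<open>r\<close> of the mass. Realizing
  \<open>S'\<close> by \<open>S\<close> on that \<open>F n\<close> leaves, up to a null set, only
  the error inside \<open>R - F n\<close>.\<close>

lemma full_group_orbit_dense:
  assumes erg: "ergodic_rel \<mu> R" and hyp: "hyperfinite_rel \<mu> R" and m: "finite_equiv_measure m M"
    and S: "subrel \<mu> R S" and ap: "aperiodic_rel \<mu> S"
    and ind: "everywhere_infinite_index \<mu> S R" and S': "subrel \<mu> R S'" and r: "r > 0"
  shows "\<exists>T\<in>full_group \<mu> R. measure m (sym_diff S' (map_prod T T ` S \<inter> R)) < r"
proof -
  interpret m: finite_measure m using m by (simp add: finite_equiv_measure_def)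
  have mM: "sets m = sets M" "null_sets m = null_sets M" using m by (auto simp: finite_equiv_measure_def)
  obtain X\<^sub>0 F where X0: "X\<^sub>0 \<in> sets \<mu>" "AE x in \<mu>. x \<in> X\<^sub>0" "incseq F" "(\<Union>n. F n) = R \<inter> (X\<^sub>0 \<times> X\<^sub>0)"
    and F: "\<And>n. F n \<in> sets (\<mu> \<Otimes>\<^sub>M \<mu>)" "\<And>n. equiv X\<^sub>0 (F n)" "\<And>n x. x \<in> X\<^sub>0 \<Longrightarrow> finite (F n `` {x})"
    by (rule hyperfiniteE[OF hyp]) (rule that, assumption+)
  note co = X0(2)
  have FR: "F n \<subseteq> R" for n using X0(4) by blast
  \<comment> \<open>Almost every \<open>R\<close>-class lies entirely in \<open>X\<^sub>0\<close>,
    and there the relations \<open>F n\<close> exhaust \<open>R\<close>.\<close>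
  have "(\<Inter>n. R - F n) \<in> null_sets M"
  proof (subst null_M_iff)
    show "(\<Inter>n. R - F n) \<in> sets (\<mu> \<Otimes>\<^sub>M \<mu>)" using F(1) by auto
    show "AE x in \<mu>. (\<Inter>n. R - F n) `` {x} = {}"
      using AE_saturate[OF co]
    proof eventually_elim
      case (elim x)
      have "(x, y) \<notin> (\<Inter>n. R - F n)" for y
      proof
        assume *: "(x, y) \<in> (\<Inter>n. R - F n)"
        then have "(x, y) \<in> R \<inter> (X\<^sub>0 \<times> X\<^sub>0)" using elim by auto
        then show False using * unfolding X0(4)[symmetric] by blast
      qed
      then show ?case by blast
    qed
  qed auto
  then have "measure m (\<Inter>n. R - F n) = 0" by (intro measure_eq_0_null_sets) (simp add: mM)
  moreover have "(\<lambda>n. measure m (R - F n)) \<longlonglongrightarrow> measure m (\<Inter>n. R - F n)"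
  proof (rule m.finite_Lim_measure_decseq)
    show "range (\<lambda>n. R - F n) \<subseteq> sets m" using F(1) by (auto simp: mM sets_M)
    show "decseq (\<lambda>n. R - F n)" using X0(3) by (auto simp: decseq_def incseq_def) 
  qed
  ultimately have "eventually (\<lambda>n. measure m (R - F n) < r) sequentially"
    using r by (metis order_tendstoD(2))
  then obtain n where n: "measure m (R - F n) < r" by (auto simp: eventually_sequentially)
  obtain T where T: "T \<in> full_group \<mu> R"
    "AE x in \<mu>. \<forall>y. (x, y) \<in> F n \<longrightarrow> ((x, y) \<in> map_prod T T ` S \<longleftrightarrow> (x, y) \<in> S')"
    using full_group_realizes[OF erg S ap ind S' F(1) FR X0(1) co F(2) F(3)] by blast
  have TS: "subrel \<mu> R (map_prod T T ` S \<inter> R)"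
    using T(1) full_group_subset by (intro subrel_image[OF S]) blast
  let ?D = "sym_diff S' (map_prod T T ` S \<inter> R)"
  have D: "?D \<in> sets (\<mu> \<Otimes>\<^sub>M \<mu>)" "?D \<subseteq> R"
    using subrel_D(1,2)[OF S'] subrel_D(1,2)[OF TS] by auto
  have "?D \<inter> F n \<in> null_sets M"
  proof (subst null_M_iff)
    show "AE x in \<mu>. (?D \<inter> F n) `` {x} = {}"
      using T(2) by eventually_elim (use FR[of n] in auto)
  qed (use D F FR in auto)
  then have nu: "?D \<inter> F n \<in> null_sets m" by (simp add: mM)
  have "measure m ?D \<le> measure m ((R - F n) \<union> (?D \<inter> F n))"
  proof (rule m.finite_measure_mono)
    show "?D \<subseteq> (R - F n) \<union> (?D \<inter> F n)" using D(2) by blast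
    show "(R - F n) \<union> (?D \<inter> F n) \<in> sets m" using D F by (auto simp: mM sets_M)
  qed
  also have "\<dots> = measure m (R - F n)"
    by (rule measure_Un_null_set) (use nu F in \<open>auto simp: mM sets_M\<close>)
  finally show ?thesis using n T(1) by (intro bexI[of _ T]) auto
qed

end

subsection \<open>Necessity of aperiodicity and of infinite index\<close>

lemma count_space_le_iff: "emeasure (count_space UNIV) B \<le> of_nat k \<longleftrightarrow> finite B \<and> card B \<le> k"
  by (auto simp: emeasure_count_space top_unique)

lemma count_space_le_card:
  assumes "emeasure (count_space UNIV) B \<le> of_nat k" "Y \<subseteq> B"
  shows "card Y \<le> k"
  using assms card_mono[of B Y] by (auto simp: count_space_le_iff)

lemma count_space_not_le:
  assumes "\<not> emeasure (count_space UNIV) B \<le> of_nat k"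
  shows "\<exists>Y\<subseteq>B. finite Y \<and> card Y = Suc k"
proof (cases "finite B")
  case True
  then have "Suc k \<le> card B" using assms by (simp add: count_space_le_iff)
  then obtain Y where "Y \<subseteq> B" "card Y = Suc k" "finite Y" by (rule obtain_subset_with_card_n)
  then show ?thesis by blast
next
  case False
  then show ?thesis using infinite_arbitrarily_large[of B "Suc k"] by metis
qed

context pmp_action
begin

section \<open>Infinite classes of the ergodic relation\<close>

text \<open>There are countably many label cells, so some point \<open>x\<close> avoids all null
  ones. The cells around \<open>x\<close> then have positive measure and shrink to
  \<open>{x}\<close>, which is null.\<close>

lemma ex_small_positive_set:
  assumes "e > 0"
  shows "\<exists>A\<in>sets \<mu>. 0 < measure \<mu> A \<and> measure \<mu> A < e"
proof -
  define fib where "fib m u = {y. label m y = u}" for m u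
  have fibm: "fib m u \<in> sets \<mu>" for m u
  proof -
    have "{y \<in> space \<mu>. label m y = u} \<in> sets \<mu>" by measurable
    then show ?thesis by (simp add: fib_def)
  qed
  have "AE x in \<mu>. measure \<mu> (fib m u) = 0 \<longrightarrow> x \<notin> fib m u" for m u
  proof (cases "measure \<mu> (fib m u) = 0")
    case True
    then have "AE x in \<mu>. x \<notin> fib m u"
      using fibm by (intro AE_not_in) (auto simp: null_sets_def emeasure_eq_measure)
    then show ?thesis by eventually_elim simp
  qed simp
  then have "AE x in \<mu>. \<forall>m. \<forall>u. measure \<mu> (fib m u) = 0 \<longrightarrow> x \<notin> fib m u"
    by (subst AE_all_countable, intro allI, subst AE_all_countable, intro allI)
  note AE = this
  have "\<exists>x. \<forall>m. \<forall>u. measure \<mu> (fib m u) = 0 \<longrightarrow> x \<notin> fib m u"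
  proof (rule ccontr)
    assume "\<nexists>x. \<forall>m. \<forall>u. measure \<mu> (fib m u) = 0 \<longrightarrow> x \<notin> fib m u"
    with AE have "AE x in \<mu>. x \<notin> space \<mu>" by (elim AE_mp) (intro AE_I2, blast)
    then show False using not_AE_D[of "space \<mu>"] emeasure_space_1 by simp
  qed
  then obtain x where x: "\<And>m u. measure \<mu> (fib m u) = 0 \<longrightarrow> x \<notin> fib m u" by blast
  have pos: "measure \<mu> (fib m (label m x)) > 0" for m
    using x[of m "label m x"] by (simp add: fib_def zero_less_measure_iff)
  have "(\<Inter>m. fib m (label m x)) = {x}"
  proof -
    have "y = x" if "\<And>m. label m y = label m x" for y
    proof -
      obtain m where m: "inj_on (label m) {x, y}" using label_separates[of "{x, y}"] by blast
      show "y = x" by (rule inj_onD[OF m that]) auto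
    qed
    then show ?thesis unfolding fib_def by blast
  qed
  moreover have "(\<lambda>m. measure \<mu> (fib m (label m x))) \<longlonglongrightarrow> measure \<mu> (\<Inter>m. fib m (label m x))"
  proof (rule finite_Lim_measure_decseq)
    show "range (\<lambda>m. fib m (label m x)) \<subseteq> sets \<mu>" using fibm by auto
    show "decseq (\<lambda>m. fib m (label m x))"
      by (auto simp: decseq_def fib_def label_def)
  qed
  moreover have "measure \<mu> {x} = 0" using atomless by (simp add: measure_def)
  ultimately have "eventually (\<lambda>m. measure \<mu> (fib m (label m x)) < e) sequentially"
    using assms by (metis order_tendstoD(2))
  then obtain m where "measure \<mu> (fib m (label m x)) < e" by (auto simp: eventually_sequentially)
  then show ?thesis using pos fibm by blast
qed

text \<open>Otherwise, by ergodicity, almost all classes have at most \<open>k\<close> points for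
  some \<open>k\<close>. By mass transport the saturation of \<open>D\<close> then has measure at
  most \<open>k\<close> times that of \<open>D\<close>, which is less than 1 if \<open>D\<close> has
  measure below \<open>1 / real (Suc k)\<close>. But the saturation of a non-null set is
  conull.\<close>

lemma infinite_classes:
  assumes erg: "ergodic_rel \<mu> R"
  shows "AE x in \<mu>. infinite (R `` {x})"
proof -
  have [measurable]: "sec_card R \<in> borel_measurable \<mu>" by (rule sec_card_meas) auto
  define A where "A k = {x. sec_card R x \<le> of_nat k}" for k :: nat
  have Am: "A k \<in> sets \<mu>" for k
  proof -
    have "{x \<in> space \<mu>. sec_card R x \<le> of_nat k} \<in> sets \<mu>" by measurable
    then show ?thesis by (simp add: A_def)
  qed
  have same: "R `` {x} = R `` {y}" if "(x, y) \<in> R" for x y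
    using that equiv_class_eq[OF equiv_R] by blast
  have null: "AE x in \<mu>. x \<notin> A k" for k
  proof (rule ccontr)
    assume "\<not> (AE x in \<mu>. x \<notin> A k)"
    then have "A k \<notin> null_sets \<mu>" using AE_not_in by blast
    moreover have "y \<in> A k" if "(x, y) \<in> R" "x \<in> A k" for x y
      using that same[OF that(1)] by (simp add: A_def)
    then have "R `` A k = A k" by (auto intro: ImageI[OF R_refl])
    ultimately have "space \<mu> - A k \<in> null_sets \<mu>"
      using erg[unfolded ergodic_rel_def, rule_format, OF Am] by blast
    then have conull: "AE x in \<mu>. x \<in> A k" by (auto dest: AE_not_in)
    obtain D where D [measurable]: "D \<in> sets \<mu>" and Dpos: "0 < measure \<mu> D" and Dlt: "measure \<mu> D < 1 / real (Suc k)"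
      using ex_small_positive_set[of "1 / real (Suc k)"] by auto
    define B where "B = {x. \<exists>n. f n x \<in> D}"
    have "{x \<in> space \<mu>. \<exists>n. f n x \<in> D} \<in> sets \<mu>" by measurable
    then have Bm [measurable]: "B \<in> sets \<mu>" by (simp add: B_def)
    have BR: "x \<in> B \<longleftrightarrow> (\<exists>y\<in>D. (x, y) \<in> R)" for x by (auto simp: B_def R_eq)
    have "AE x in \<mu>. x \<in> B"
      using ergodic_AE_visits[OF erg D] Dpos by (simp add: B_def emeasure_eq_measure)
    then have B1: "emeasure \<mu> B = 1" using AE_conull[OF Bm] by simp
    have U [measurable]: "UNIV \<in> sets \<mu>" using sets.top[of \<mu>] by simp
    define E where "E = R \<inter> (D \<times> UNIV)"
    have E: "E \<in> sets (\<mu> \<Otimes>\<^sub>M \<mu>)" "E \<subseteq> R" unfolding E_def by auto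
    have "emeasure \<mu> B = (\<integral>\<^sup>+x. indicator B x \<partial>\<mu>)" by simp
    also have "\<dots> \<le> (\<integral>\<^sup>+x. sec_card (E\<inverse>) x \<partial>\<mu>)"
    proof (intro nn_integral_mono)
      fix x show "indicator B x \<le> sec_card (E\<inverse>) x"
      proof (cases "x \<in> B")
        case True
        then obtain y where "y \<in> D" "(y, x) \<in> R" using BR R_sym by blast
        then have "{y} \<subseteq> E\<inverse> `` {x}" by (auto simp: E_def)
        then have "emeasure (count_space UNIV) {y} \<le> sec_card (E\<inverse>) x" by (intro emeasure_mono) auto
        then show ?thesis using True by simp
      qed simp
    qed
    also have "\<dots> = (\<integral>\<^sup>+x. sec_card E x \<partial>\<mu>)" by (rule mass_transport[OF E, symmetric])
    also have "\<dots> \<le> (\<integral>\<^sup>+x. of_nat k * indicator D x \<partial>\<mu>)"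
    proof (rule nn_integral_mono_AE)
      show "AE x in \<mu>. sec_card E x \<le> of_nat k * indicator D x"
        using conull
      proof eventually_elim
        case (elim x)
        show ?case
        proof (cases "x \<in> D")
          case True
          then have "E `` {x} = R `` {x}" by (auto simp: E_def)
          then show ?thesis using True elim by (simp add: A_def)
        next
          case False
          then have "E `` {x} = {}" by (auto simp: E_def)
          then show ?thesis by simp
        qed
      qed
    qed
    also have "\<dots> = of_nat k * emeasure \<mu> D" by (rule nn_integral_cmult_indicator) simp
    also have "\<dots> = ennreal (real k * measure \<mu> D)"
      by (simp add: emeasure_eq_measure ennreal_mult ennreal_of_nat_eq_real_of_nat)
    finally have "1 \<le> ennreal (real k * measure \<mu> D)" using B1 by simp
    then have "1 \<le> real k * measure \<mu> D" by simp
    moreover have "real k * measure \<mu> D \<le> real k * (1 / real (Suc k))"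
      using Dlt by (intro mult_left_mono) auto
    moreover have "real k * (1 / real (Suc k)) < 1" by simp
    ultimately show False by linarith
  qed
  have "AE x in \<mu>. \<forall>k. x \<notin> A k" by (subst AE_all_countable) (intro allI null)
  then show ?thesis
    by eventually_elim (auto simp: A_def emeasure_count_space)
qed

text \<open>The limit superior of the sets \<open>C n\<close> is a decreasing limit of sets of
  measure at least \<open>d\<close>, whereas the assumption makes it null.\<close>

lemma not_eventually_outside:
  assumes C: "\<And>n :: nat. C n \<in> sets \<mu>" and d: "d > 0" "\<And>n. measure \<mu> (C n) \<ge> d"
    and ev: "AE x in \<mu>. eventually (\<lambda>n. x \<notin> C n) sequentially"
  shows False
proof -
  have "AE x in \<mu>. x \<notin> (\<Inter>n. \<Union>k\<in>{n..}. C k)"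
    using ev by eventually_elim (auto simp: eventually_sequentially)
  moreover have m: "(\<Inter>n. \<Union>k\<in>{n..}. C k) \<in> sets \<mu>" using C by auto
  ultimately have "(\<Inter>n. \<Union>k\<in>{n..}. C k) \<in> null_sets \<mu>" using AE_iff_null_sets[OF m] by simp
  then have "measure \<mu> (\<Inter>n. \<Union>k\<in>{n..}. C k) = 0" by (rule measure_eq_0_null_sets)
  moreover have "(\<lambda>n. measure \<mu> (\<Union>k\<in>{n..}. C k)) \<longlonglongrightarrow> measure \<mu> (\<Inter>n. \<Union>k\<in>{n..}. C k)"
  proof (rule finite_Lim_measure_decseq)
    show "range (\<lambda>n. \<Union>k\<in>{n..}. C k) \<subseteq> sets \<mu>" using C by auto
    show "decseq (\<lambda>n. \<Union>k\<in>{n..}. C k)" unfolding decseq_def by (intro allI impI UN_mono) auto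
  qed
  ultimately have "eventually (\<lambda>n. measure \<mu> (\<Union>k\<in>{n..}. C k) < d) sequentially"
    using d(1) by (metis order_tendstoD(2))
  then obtain n where "measure \<mu> (\<Union>k\<in>{n..}. C k) < d" by (auto simp: eventually_sequentially)
  moreover have "measure \<mu> (C n) \<le> measure \<mu> (\<Union>k\<in>{n..}. C k)"
    by (rule finite_measure_mono) (use C in auto)
  ultimately show False using d(2)[of n] by linarith
qed

section \<open>Pointwise limits along an orbit\<close>

text \<open>Approximations with errors below \<open>(1/2) ^ n\<close> have summable errors, so
  Borel-Cantelli applies to almost every pair, and \<open>AE_M_D\<close> passes to all pairs of
  almost every class. The inverses \<open>U n\<close> serve to express membership in the translates
  of \<open>S\<close>.\<close>

lemma AE_convergent_orbit_sequence:
  assumes m: "finite_equiv_measure m M" and S: "subrel \<mu> R S" and S': "subrel \<mu> R S'" and H: "H \<subseteq> meas_aut \<mu>"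
    and dense: "\<And>r. r > 0 \<Longrightarrow> \<exists>T\<in>H. measure m (sym_diff S' (map_prod T T ` S \<inter> R)) < r"
  obtains T U where "\<And>n :: nat. T n \<in> H" "\<And>n x. T n (U n x) = x" "\<And>n x. U n (T n x) = x"
    "\<And>n. U n \<in> \<mu> \<rightarrow>\<^sub>M \<mu>" "\<And>n A. A \<in> sets \<mu> \<Longrightarrow> emeasure \<mu> (U n -` A) = emeasure \<mu> A"
    "AE x in \<mu>. \<forall>y z. (x, y) \<in> R \<longrightarrow> (x, z) \<in> R \<longrightarrow>
      eventually (\<lambda>n. (U n y, U n z) \<in> S \<longleftrightarrow> (y, z) \<in> S') sequentially"
proof -
  interpret m: finite_measure m using m by (simp add: finite_equiv_measure_def)
  have mM: "sets m = sets M" "null_sets m = null_sets M" using m by (auto simp: finite_equiv_measure_def)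
  have "\<exists>T\<in>H. measure m (sym_diff S' (map_prod T T ` S \<inter> R)) < (1/2) ^ n" for n
    by (rule dense) simp
  then obtain T where T: "\<And>n :: nat. T n \<in> H"
    "\<And>n. measure m (sym_diff S' (map_prod (T n) (T n) ` S \<inter> R)) < (1/2) ^ n" by metis
  have "\<exists>U. (\<forall>x. T n (U x) = x) \<and> (\<forall>x. U (T n x) = x) \<and> U \<in> \<mu> \<rightarrow>\<^sub>M \<mu> \<and>
      (\<forall>A. A \<in> sets \<mu> \<longrightarrow> emeasure \<mu> (U -` A) = emeasure \<mu> A)" for n
  proof -
    have "T n \<in> meas_aut \<mu>" using T(1) H by blast
    then obtain U where "\<And>x. T n (U x) = x" "\<And>x. U (T n x) = x" "U \<in> \<mu> \<rightarrow>\<^sub>M \<mu>"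
      "\<And>A. A \<in> sets \<mu> \<Longrightarrow> emeasure \<mu> (U -` A) = emeasure \<mu> A" by (rule meas_autD) (rule that, assumption+)
    then show ?thesis by (intro exI[of _ U]) simp
  qed
  then obtain U where U: "\<And>n x. T n (U n x) = x" "\<And>n x. U n (T n x) = x"
    "\<And>n. U n \<in> \<mu> \<rightarrow>\<^sub>M \<mu>" "\<And>n A. A \<in> sets \<mu> \<Longrightarrow> emeasure \<mu> (U n -` A) = emeasure \<mu> A" by metis
  define A where "A n = sym_diff S' (map_prod (T n) (T n) ` S \<inter> R)" for n
  have Am: "A n \<in> sets m" for n
  proof -
    have s: "subrel \<mu> R (map_prod (T n) (T n) ` S \<inter> R)" using subrel_image[OF S] T(1) H by blast
    show ?thesis using subrel_D(1,2)[OF s] subrel_D(1,2)[OF S'] by (auto simp: A_def mM sets_M)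
  qed
  have sum: "summable (\<lambda>n. measure m (A n))"
  proof (rule summable_comparison_test')
    show "summable (\<lambda>n. (1/2 :: real) ^ n)" by (rule summable_geometric) simp
    show "norm (measure m (A n)) \<le> (1/2) ^ n" if "n \<ge> 0" for n
      using T(2)[of n] by (simp add: A_def)
  qed
  have "AE p in m. eventually (\<lambda>n. p \<in> space m - A n) sequentially"
    by (rule borel_cantelli_AE1[OF Am _ sum]) (simp add: m.emeasure_eq_measure)
  then have "AE p in M. eventually (\<lambda>n. p \<notin> A n) sequentially"
  proof -
    assume "AE p in m. eventually (\<lambda>n. p \<in> space m - A n) sequentially"
    then have "AE p in m. eventually (\<lambda>n. p \<notin> A n) sequentially"
      by (rule AE_mp) (auto elim: eventually_mono)
    then obtain N where N: "{p \<in> space m. \<not> eventually (\<lambda>n. p \<notin> A n) sequentially} \<subseteq> N"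
      "emeasure m N = 0" "N \<in> sets m" by (rule AE_E)
    have "N \<in> null_sets M" using N mM(2) by auto
    moreover have "space m = space M" by (rule sets_eq_imp_space_eq[OF mM(1)])
    ultimately show ?thesis using N(1) by (intro AE_I'[of N]) auto
  qed
  from AE_M_D[OF this]
  have "AE x in \<mu>. \<forall>y z. (x, y) \<in> R \<longrightarrow> (x, z) \<in> R \<longrightarrow>
      eventually (\<lambda>n. (U n y, U n z) \<in> S \<longleftrightarrow> (y, z) \<in> S') sequentially"
  proof eventually_elim
    case (elim x)
    show ?case
    proof (intro allI impI)
      fix y z assume xy: "(x, y) \<in> R" "(x, z) \<in> R"
      then have yz: "(y, z) \<in> R" using R_sym R_trans by meson
      have "eventually (\<lambda>n. (y, z) \<notin> A n) sequentially" using elim xy by blast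
      then show "eventually (\<lambda>n. (U n y, U n z) \<in> S \<longleftrightarrow> (y, z) \<in> S') sequentially"
      proof (rule eventually_mono)
        fix n assume "(y, z) \<notin> A n"
        moreover have "(y, z) \<in> map_prod (T n) (T n) ` S \<longleftrightarrow> (U n y, U n z) \<in> S"
          by (rule map_prod_image_iff[OF U(1,2)])
        ultimately show "(U n y, U n z) \<in> S \<longleftrightarrow> (y, z) \<in> S'" using yz unfolding A_def by blast
      qed
    qed
  qed
  then show ?thesis using that[of T U] T(1) U by blast
qed

text \<open>The target is \<open>R\<close> itself. For almost every \<open>x\<close>, any
  \<open>Suc k\<close> points of its infinite class are eventually carried by \<open>U n\<close>
  into the \<open>S\<close>-class of \<open>U n x\<close>, so \<open>x\<close> eventually leaves the
  preimage of \<open>B k\<close>. These preimages all have the measure of \<open>B k\<close>, which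
  must therefore vanish.\<close>

lemma dense_imp_aperiodic:
  assumes erg: "ergodic_rel \<mu> R" and m: "finite_equiv_measure m M" and S: "subrel \<mu> R S" and H: "H \<subseteq> meas_aut \<mu>"
    and dense: "\<And>S' r. subrel \<mu> R S' \<Longrightarrow> r > 0 \<Longrightarrow> \<exists>T\<in>H. measure m (sym_diff S' (map_prod T T ` S \<inter> R)) < r"
  shows "aperiodic_rel \<mu> S"
proof -
  have R': "subrel \<mu> R R" using equiv_R by (simp add: subrel_def)
  obtain T U where TU: "\<And>n :: nat. T n \<in> H" "\<And>n x. T n (U n x) = x" "\<And>n x. U n (T n x) = x"
    "\<And>n. U n \<in> \<mu> \<rightarrow>\<^sub>M \<mu>" "\<And>n A. A \<in> sets \<mu> \<Longrightarrow> emeasure \<mu> (U n -` A) = emeasure \<mu> A"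
    and conv: "AE x in \<mu>. \<forall>y z. (x, y) \<in> R \<longrightarrow> (x, z) \<in> R \<longrightarrow>
      eventually (\<lambda>n. (U n y, U n z) \<in> S \<longleftrightarrow> (y, z) \<in> R) sequentially"
    by (rule AE_convergent_orbit_sequence[OF m S R' H dense[OF R']]) (assumption, rule that, assumption+)
  note [measurable] = TU(4)
  have [measurable]: "sec_card S \<in> borel_measurable \<mu>" by (rule sec_card_meas[OF subrel_D(1,2)[OF S]])
  define B where "B k = {x. sec_card S x \<le> of_nat k}" for k :: nat
  have Bm [measurable]: "B k \<in> sets \<mu>" for k
  proof -
    have "{x \<in> space \<mu>. sec_card S x \<le> of_nat k} \<in> sets \<mu>" by measurable
    then show ?thesis by (simp add: B_def)
  qed
  have "AE x in \<mu>. x \<notin> B k" for k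
  proof (rule ccontr)
    assume "\<not> (AE x in \<mu>. x \<notin> B k)"
    then have pos: "measure \<mu> (B k) > 0"
      using positive_iff[OF Bm] by (simp add: emeasure_eq_measure)
    have Cm: "U n -` B k \<in> sets \<mu>" for n using measurable_sets[OF TU(4) Bm] by simp
    show False
    proof (rule not_eventually_outside[of "\<lambda>n. U n -` B k", OF Cm pos])
      show "measure \<mu> (B k) \<le> measure \<mu> (U n -` B k)" for n using TU(5)[OF Bm] by (simp add: measure_def)
      show "AE x in \<mu>. eventually (\<lambda>n. x \<notin> U n -` B k) sequentially"
        using conv infinite_classes[OF erg]
      proof eventually_elim
        case (elim x)
        obtain Y where Y: "Y \<subseteq> R `` {x}" "finite Y" "card Y = Suc k"
          using infinite_arbitrarily_large[OF elim(2)] by blast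
        have "eventually (\<lambda>n. \<forall>y\<in>Y. (U n x, U n y) \<in> S) sequentially"
        proof (rule eventually_ball_finite[OF Y(2)], rule ballI)
          fix y assume "y \<in> Y"
          then have "(x, y) \<in> R" using Y(1) by auto
          then have "eventually (\<lambda>n. (U n x, U n y) \<in> S \<longleftrightarrow> (x, y) \<in> R) sequentially"
            using elim(1) R_refl by blast
          then show "eventually (\<lambda>n. (U n x, U n y) \<in> S) sequentially"
            by (rule eventually_mono) (use \<open>(x, y) \<in> R\<close> in simp)
        qed
        then show ?case
        proof (rule eventually_mono)
          fix n assume n: "\<forall>y\<in>Y. (U n x, U n y) \<in> S"
          show "x \<notin> U n -` B k"
          proof
            assume "x \<in> U n -` B k"
            then have "sec_card S (U n x) \<le> of_nat k" by (simp add: B_def)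
            moreover have "U n ` Y \<subseteq> S `` {U n x}" using n by auto
            ultimately have "card (U n ` Y) \<le> k" by (rule count_space_le_card)
            moreover have "inj_on (U n) Y" using TU(2) by (metis inj_onI)
            ultimately show False using Y(3) by (simp add: card_image)
          qed
        qed
      qed
    qed
  qed
  then have "AE x in \<mu>. \<forall>k. x \<notin> B k" by (subst AE_all_countable) (rule allI)
  then show ?thesis unfolding aperiodic_rel_def
    by eventually_elim (auto simp: B_def emeasure_count_space)
qed


section \<open>Finite index against large finite classes\<close>

text \<open>In almost every class, \<open>Suc K\<close> points get absorbed into one class of
  \<open>F n\<close> for large \<open>n\<close>. So the sets of points with a small
  \<open>F n\<close>-class decrease to a null set.\<close>

lemma hyperfinite_large_classes:
  assumes erg: "ergodic_rel \<mu> R"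
    and co: "AE x in \<mu>. x \<in> X\<^sub>0" and F: "incseq F" "(\<Union>n :: nat. F n) = R \<inter> (X\<^sub>0 \<times> X\<^sub>0)"
    "\<And>n. F n \<in> sets (\<mu> \<Otimes>\<^sub>M \<mu>)" and e: "e > 0"
  shows "\<exists>N. measure \<mu> {x. sec_card (F N) x \<le> of_nat K} < e"
proof -
  have FR: "F n \<subseteq> R" for n using F(2) by blast
  define L where "L n = {x. sec_card (F n) x \<le> of_nat K}" for n
  have Lm: "L n \<in> sets \<mu>" for n
  proof -
    note [measurable] = sec_card_meas[OF F(3) FR]
    have "{x \<in> space \<mu>. sec_card (F n) x \<le> of_nat K} \<in> sets \<mu>" by measurable
    then show ?thesis by (simp add: L_def)
  qed
  have "AE x in \<mu>. x \<notin> (\<Inter>n. L n)"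
    using infinite_classes[OF erg] AE_saturate[OF co]
  proof eventually_elim
    case (elim x)
    obtain Y where Y: "Y \<subseteq> R `` {x}" "finite Y" "card Y = Suc K"
      using infinite_arbitrarily_large[OF elim(1)] by blast
    have "eventually (\<lambda>n. \<forall>y\<in>Y. (x, y) \<in> F n) sequentially"
    proof (rule eventually_ball_finite[OF Y(2)], rule ballI)
      fix y assume "y \<in> Y"
      then have "(x, y) \<in> R \<inter> (X\<^sub>0 \<times> X\<^sub>0)" using Y(1) elim(2) by auto
      then obtain n where "(x, y) \<in> F n" unfolding F(2)[symmetric] by blast
      then show "eventually (\<lambda>n. (x, y) \<in> F n) sequentially"
        using F(1) unfolding eventually_sequentially incseq_def by blast
    qed
    then obtain n where n: "\<forall>y\<in>Y. (x, y) \<in> F n" by (auto simp: eventually_sequentially)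
    have "x \<notin> L n"
    proof
      assume "x \<in> L n"
      then have "card Y \<le> K" unfolding L_def mem_Collect_eq
        by (rule count_space_le_card) (use n in auto)
      then show False using Y(3) by simp
    qed
    then show ?case by blast
  qed
  moreover have m: "(\<Inter>n. L n) \<in> sets \<mu>" using Lm by auto
  ultimately have "(\<Inter>n. L n) \<in> null_sets \<mu>" using AE_iff_null_sets[OF m] by simp
  then have "measure \<mu> (\<Inter>n. L n) = 0" by (rule measure_eq_0_null_sets)
  moreover have "(\<lambda>n. measure \<mu> (L n)) \<longlonglongrightarrow> measure \<mu> (\<Inter>n. L n)"
  proof (rule finite_Lim_measure_decseq)
    show "range L \<subseteq> sets \<mu>" using Lm by auto
    show "decseq L" unfolding decseq_def
    proof (intro allI impI subsetI)
      fix i j x assume "i \<le> j" "x \<in> L j"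
      have "F i `` {x} \<subseteq> F j `` {x}" using incseqD[OF F(1) \<open>i \<le> j\<close>] by blast
      then have "sec_card (F i) x \<le> sec_card (F j) x" by (intro emeasure_mono) auto
      then show "x \<in> L i" using \<open>x \<in> L j\<close> by (simp add: L_def)
    qed
  qed
  ultimately have "eventually (\<lambda>n. measure \<mu> (L n) < e) sequentially"
    using e by (metis order_tendstoD(2))
  then show ?thesis by (auto simp: eventually_sequentially L_def)
qed

text \<open>A Markov inequality: points of \<open>W\<close> outside the exceptional set receive mass
  more than \<open>K\<close>, while the total mass is at most \<open>k\<close> by
  \<open>transport_bound\<close>.\<close>

lemma transport_bound_measure:
  assumes E: "E \<in> sets (\<mu> \<Otimes>\<^sub>M \<mu>)" "E \<subseteq> R" "sym E" "trans E"
    and W [measurable]: "W \<in> sets \<mu>" and k: "\<And>y. y \<in> W \<Longrightarrow> emeasure (count_space UNIV) (E `` {y} \<inter> W) \<le> of_nat k"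
    and K: "K > 0"
  shows "measure \<mu> W \<le> measure \<mu> {x. sec_card E x \<le> of_nat K} + real k / real K"
proof -
  define L where "L = {x. sec_card E x \<le> of_nat K}"
  note [measurable] = sec_card_meas[OF E(1,2)]
  have "{x \<in> space \<mu>. sec_card E x \<le> of_nat K} \<in> sets \<mu>" by measurable
  then have Lm [measurable]: "L \<in> sets \<mu>" by (simp add: L_def)
  have "(\<integral>\<^sup>+y. of_nat K * indicator (W - L) y \<partial>\<mu>) \<le> (\<integral>\<^sup>+y. sec_card E y * indicator W y \<partial>\<mu>)"
    by (intro nn_integral_mono) (auto simp: indicator_def L_def)
  also have "\<dots> \<le> of_nat k" by (rule transport_bound[OF E W k])
  finally have "of_nat K * emeasure \<mu> (W - L) \<le> of_nat k"
    by (simp add: nn_integral_cmult_indicator)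
  then have "real K * measure \<mu> (W - L) \<le> real k"
    by (simp add: emeasure_eq_measure ennreal_of_nat_eq_real_of_nat flip: ennreal_mult)
  then have "measure \<mu> (W - L) \<le> real k / real K" using K by (simp add: field_simps)
  moreover have "measure \<mu> W \<le> measure \<mu> (L \<union> (W - L))" by (rule finite_measure_mono) auto
  moreover have "measure \<mu> (L \<union> (W - L)) \<le> measure \<mu> L + measure \<mu> (W - L)" by (rule measure_Un_le) auto
  ultimately show ?thesis by (simp add: L_def)
qed

text \<open>The points of \<open>A\<close> whose class in the restriction of \<open>R\<close> contains at most \<open>k\<close> classes of the
  restriction of \<open>S\<close>, described by countably many conditions so that measurability is evident.\<close>

definition small_index :: "'a rel \<Rightarrow> 'a set \<Rightarrow> nat \<Rightarrow> 'a set" where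
  "small_index S A k = {x \<in> A. \<forall>as. length as = Suc k \<longrightarrow> (\<forall>i<Suc k. f (as ! i) x \<in> A) \<longrightarrow>
    (\<exists>i<Suc k. \<exists>j<Suc k. i \<noteq> j \<and> (f (as ! i) x, f (as ! j) x) \<in> S)}"

lemma small_index_meas:
  assumes [measurable]: "S \<in> sets (\<mu> \<Otimes>\<^sub>M \<mu>)" "A \<in> sets \<mu>"
  shows "small_index S A k \<in> sets \<mu>"
proof -
  have "{x \<in> space \<mu>. x \<in> A \<and> (\<forall>as. length as = Suc k \<longrightarrow> (\<forall>i<Suc k. f (as ! i) x \<in> A) \<longrightarrow>
    (\<exists>i<Suc k. \<exists>j<Suc k. i \<noteq> j \<and> (f (as ! i) x, f (as ! j) x) \<in> S))} \<in> sets \<mu>"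
    by measurable
  then show ?thesis by (simp add: small_index_def)
qed

text \<open>Pigeonhole, with \<open>k\<close> the number of classes: among \<open>Suc k\<close>
  listed points two fall into the same class.\<close>

lemma finite_index_imp_small_index:
  assumes S: "subrel \<mu> R S" and x: "x \<in> A" and fin: "finite ((restr_rel R A `` {x}) // restr_rel S A)"
  shows "\<exists>k. x \<in> small_index S A k"
proof -
  let ?Q = "(restr_rel R A `` {x}) // restr_rel S A"
  have "x \<in> small_index S A (card ?Q)"
    unfolding small_index_def mem_Collect_eq
  proof (intro conjI x allI impI)
    fix as assume as: "length as = Suc (card ?Q)" "\<forall>i<Suc (card ?Q). f (as ! i) x \<in> A"
    define c where "c i = restr_rel S A `` {f (as ! i) x}" for i
    have "c ` {..<Suc (card ?Q)} \<subseteq> ?Q"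
    proof
      fix q assume "q \<in> c ` {..<Suc (card ?Q)}"
      then obtain i where i: "i < Suc (card ?Q)" "q = c i" by blast
      then have "f (as ! i) x \<in> restr_rel R A `` {x}" using as(2) x by (simp add: restr_rel_def)
      then show "q \<in> ?Q" unfolding i(2) c_def by (rule quotientI)
    qed
    then have "card (c ` {..<Suc (card ?Q)}) \<le> card ?Q" using fin by (rule card_mono[rotated])
    then have "\<not> inj_on c {..<Suc (card ?Q)}" by (intro pigeonhole) simp
    then obtain i j where ij: "i < Suc (card ?Q)" "j < Suc (card ?Q)" "i \<noteq> j" "c i = c j"
      by (auto simp: inj_on_def)
    have "f (as ! j) x \<in> c j" using as(2) ij(2) subrel_D(5)[OF S] by (simp add: c_def restr_rel_def)
    then have "(f (as ! i) x, f (as ! j) x) \<in> S"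
      unfolding ij(4)[symmetric] by (simp add: c_def restr_rel_def)
    then show "\<exists>i<Suc (card ?Q). \<exists>j<Suc (card ?Q). i \<noteq> j \<and> (f (as ! i) x, f (as ! j) x) \<in> S"
      using ij by blast
  qed
  then show ?thesis by blast
qed

text \<open>If infinite index fails, some \<open>small_index\<close> set \<open>B\<close> has
  positive measure \<open>d\<close>. Its preimages \<open>C n\<close> under \<open>U n\<close> keep
  measure \<open>d\<close>, and at least half of each consists of points with more than
  \<open>k\<close> members of \<open>C n\<close> in their finite \<open>E\<close>-class. Their
  \<open>U n\<close>-images contain two \<open>S\<close>-related points, which convergence of the
  translates to \<open>Id\<close> eventually forbids on each finite class.\<close>

lemma dense_imp_infinite_index:
  assumes erg: "ergodic_rel \<mu> R" and hyp: "hyperfinite_rel \<mu> R"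
    and m: "finite_equiv_measure m M" and S: "subrel \<mu> R S" and H: "H \<subseteq> Aut_rel \<mu> R"
    and dense: "\<And>S' r. subrel \<mu> R S' \<Longrightarrow> r > 0 \<Longrightarrow> \<exists>T\<in>H. measure m (sym_diff S' (map_prod T T ` S \<inter> R)) < r"
  shows "everywhere_infinite_index \<mu> S R"
proof (rule ccontr)
  assume "\<not> everywhere_infinite_index \<mu> S R"
  then obtain A where A: "A \<in> sets \<mu>"
    and nAE: "\<not> (AE x in \<mu>. x \<in> A \<longrightarrow> infinite ((restr_rel R A `` {x}) // restr_rel S A))"
    by (auto simp: everywhere_infinite_index_def)
  have Bm': "small_index S A k \<in> sets \<mu>" for k by (rule small_index_meas[OF subrel_D(1)[OF S] A])
  have "\<exists>k. \<not> (AE x in \<mu>. x \<notin> small_index S A k)"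
  proof (rule ccontr)
    assume "\<nexists>k. \<not> (AE x in \<mu>. x \<notin> small_index S A k)"
    then have "AE x in \<mu>. \<forall>k. x \<notin> small_index S A k" by (subst AE_all_countable) simp
    then have "AE x in \<mu>. x \<in> A \<longrightarrow> infinite ((restr_rel R A `` {x}) // restr_rel S A)"
      by eventually_elim (use finite_index_imp_small_index[OF S] in meson)
    then show False using nAE by simp
  qed
  then obtain k where "\<not> (AE x in \<mu>. x \<notin> small_index S A k)" by blast
  define B where "B = small_index S A k"
  have Bm [measurable]: "B \<in> sets \<mu>" using Bm' by (simp add: B_def)
  define d where "d = measure \<mu> B"
  have d: "d > 0"
    using positive_iff[OF Bm] \<open>\<not> (AE x in \<mu>. x \<notin> small_index S A k)\<close>
    by (simp add: d_def B_def emeasure_eq_measure)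
  have "{(x, y). y = x} \<in> sets (\<mu> \<Otimes>\<^sub>M \<mu>)" by (rule graph_meas) simp
  also have "{(x, y). y = x} = (Id :: 'a rel)" by auto
  finally have I: "subrel \<mu> R Id"
    by (auto simp: subrel_def equiv_def refl_on_def sym_def trans_def)
  obtain T U where TU: "\<And>n :: nat. T n \<in> H" "\<And>n x. T n (U n x) = x" "\<And>n x. U n (T n x) = x"
    "\<And>n. U n \<in> \<mu> \<rightarrow>\<^sub>M \<mu>" "\<And>n A. A \<in> sets \<mu> \<Longrightarrow> emeasure \<mu> (U n -` A) = emeasure \<mu> A"
    and conv: "AE x in \<mu>. \<forall>y z. (x, y) \<in> R \<longrightarrow> (x, z) \<in> R \<longrightarrow>
      eventually (\<lambda>n. (U n y, U n z) \<in> S \<longleftrightarrow> (y, z) \<in> Id) sequentially"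
    by (rule AE_convergent_orbit_sequence[OF m S I order_trans[OF H full_group_subset(2)] dense[OF I]])
      (assumption, rule that, assumption+)
  obtain X\<^sub>0 F where X0: "X\<^sub>0 \<in> sets \<mu>" "AE x in \<mu>. x \<in> X\<^sub>0" "incseq F" "(\<Union>n. F n) = R \<inter> (X\<^sub>0 \<times> X\<^sub>0)"
    and F: "\<And>n. F n \<in> sets (\<mu> \<Otimes>\<^sub>M \<mu>)" "\<And>n. equiv X\<^sub>0 (F n)" "\<And>n x. x \<in> X\<^sub>0 \<Longrightarrow> finite (F n `` {x})"
    by (rule hyperfiniteE[OF hyp]) (rule that, assumption+)
  \<comment> \<open>The two terms of \<open>transport_bound_measure\<close> are each kept to at most
    \<open>d / 4\<close>: first \<open>K\<close> makes \<open>k / K\<close> small, then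
    \<open>N\<close> makes classes of size at most \<open>K\<close> rare.\<close>
  obtain K where K: "real k / (d / 4) < real K" using reals_Archimedean2 by blast
  have K0: "K > 0" using K d by (cases K) (auto simp: field_simps)
  have kK: "real k / real K \<le> d / 4" using K K0 d by (simp add: field_simps)
  obtain N where N: "measure \<mu> {x. sec_card (F N) x \<le> of_nat K} < d / 4"
    using hyperfinite_large_classes[OF erg X0(2,3,4) F(1), of "d / 4" K] d by auto
  define E where "E = F N"
  have E: "E \<in> sets (\<mu> \<Otimes>\<^sub>M \<mu>)" "E \<subseteq> R" "sym E" "trans E" "\<And>x. x \<in> X\<^sub>0 \<Longrightarrow> finite (E `` {x})"
    using F X0(4) by (auto simp: E_def equiv_def)
  have U' [measurable]: "UNIV \<in> sets \<mu>" using sets.top[of \<mu>] by simp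
  define C where "C n = U n -` B" for n
  have Cm [measurable]: "C n \<in> sets \<mu>" for n using measurable_sets[OF TU(4) Bm, of n] by (simp add: C_def)
  have Cd: "measure \<mu> (C n) = d" for n using TU(5)[OF Bm, of n] by (simp add: C_def d_def measure_def)
  \<comment> \<open>These are the points of \<open>C n\<close> with too few companions for the
    pigeonhole argument; the class count includes the point itself.\<close>
  define W where "W n = {x \<in> C n. emeasure (count_space UNIV) (E `` {x} \<inter> C n) \<le> of_nat k}" for n
  have Wm [measurable]: "W n \<in> sets \<mu>" for n
  proof -
    have EC: "E \<inter> (UNIV \<times> C n) \<in> sets (\<mu> \<Otimes>\<^sub>M \<mu>)" "E \<inter> (UNIV \<times> C n) \<subseteq> R" using E(1,2) by auto
    note [measurable] = sec_card_meas[OF EC]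
    have "{x \<in> space \<mu>. x \<in> C n \<and> sec_card (E \<inter> (UNIV \<times> C n)) x \<le> of_nat k} \<in> sets \<mu>" by measurable
    moreover have "(E \<inter> (UNIV \<times> C n)) `` {x} = E `` {x} \<inter> C n" for x by auto
    ultimately show ?thesis by (simp add: W_def)
  qed
  have Wd: "measure \<mu> (W n) \<le> d / 2" for n
  proof -
    have "measure \<mu> (W n) \<le> measure \<mu> {x. sec_card E x \<le> of_nat K} + real k / real K"
    proof (rule transport_bound_measure[OF E(1-4) Wm _ K0])
      fix y assume y: "y \<in> W n"
      have "emeasure (count_space UNIV) (E `` {y} \<inter> W n) \<le> emeasure (count_space UNIV) (E `` {y} \<inter> C n)"
        by (rule emeasure_mono) (auto simp: W_def)
      also have "\<dots> \<le> of_nat k" using y by (simp add: W_def)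
      finally show "emeasure (count_space UNIV) (E `` {y} \<inter> W n) \<le> of_nat k" .
    qed
    then show ?thesis using N kK unfolding E_def by linarith
  qed
  have "AE x in \<mu>. (map_prod (T n) (T n) ` R) `` {x} = R `` {x}" for n
    using TU(1)[of n] H by (auto simp: Aut_rel_def)
  then have aut: "AE x in \<mu>. \<forall>n. (map_prod (T n) (T n) ` R) `` {x} = R `` {x}"
    by (subst AE_all_countable) (rule allI)
  show False
  proof (rule not_eventually_outside[of "\<lambda>n. C n - W n" "d / 2"])
    show "C n - W n \<in> sets \<mu>" for n by measurable
    show "d / 2 > 0" using d by simp
    show "d / 2 \<le> measure \<mu> (C n - W n)" for n
    proof -
      have "measure \<mu> (C n - W n) = measure \<mu> (C n) - measure \<mu> (W n)"
        by (rule finite_measure_Diff[OF Cm Wm]) (auto simp: W_def)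
      then show ?thesis using Cd[of n] Wd[of n] by simp
    qed
    show "AE x in \<mu>. eventually (\<lambda>n. x \<notin> C n - W n) sequentially"
      using conv aut X0(2)
    proof eventually_elim
      case (elim x)
      have fin: "finite (E `` {x})" using E(5) elim(3) by blast
      \<comment> \<open>Finiteness of the \<open>E\<close>-class allows a single threshold for all
        its pairs.\<close>
      have "eventually (\<lambda>n. \<forall>y\<in>E `` {x}. \<forall>z\<in>E `` {x}. (U n y, U n z) \<in> S \<longleftrightarrow> (y, z) \<in> Id) sequentially"
      proof (intro eventually_ball_finite[OF fin] ballI)
        fix y z assume "y \<in> E `` {x}" "z \<in> E `` {x}"
        then have "(x, y) \<in> R" "(x, z) \<in> R" using E(2) by auto
        then show "eventually (\<lambda>n. (U n y, U n z) \<in> S \<longleftrightarrow> (y, z) \<in> Id) sequentially"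
          using elim(1) by blast
      qed
      then show ?case
      proof (rule eventually_mono)
        fix n assume n: "\<forall>y\<in>E `` {x}. \<forall>z\<in>E `` {x}. (U n y, U n z) \<in> S \<longleftrightarrow> (y, z) \<in> Id"
        show "x \<notin> C n - W n"
        proof
          assume x: "x \<in> C n - W n"
          then have "\<not> emeasure (count_space UNIV) (E `` {x} \<inter> C n) \<le> of_nat k" by (simp add: W_def)
          then obtain Y where Y: "Y \<subseteq> E `` {x} \<inter> C n" "finite Y" "card Y = Suc k"
            using count_space_not_le by blast
          obtain ys where ys: "set ys = Y" "distinct ys" using finite_distinct_list[OF Y(2)] by blast
          have len: "length ys = Suc k" using ys Y(3) distinct_card by fastforce
          \<comment> \<open>Here \<open>T n\<close> enters as an automorphism of \<open>R\<close>:
            the points of \<open>Y\<close> share the \<open>R\<close>-class of \<open>x\<close>, so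
            their images share that of \<open>U n x\<close> and can be listed from there.\<close>
          have "\<exists>a. U n y = f a (U n x)" if "y \<in> Y" for y
          proof -
            have "(x, y) \<in> R" using that Y(1) E(2) by blast
            then have "y \<in> (map_prod (T n) (T n) ` R) `` {x}" using elim(2) by simp
            then have "(x, y) \<in> map_prod (T n) (T n) ` R" by (rule Image_singleton_iff[THEN iffD1])
            moreover have "(x, y) \<in> map_prod (T n) (T n) ` R \<longleftrightarrow> (U n x, U n y) \<in> R"
              by (rule map_prod_image_iff[OF TU(2,3)])
            ultimately have "(U n x, U n y) \<in> R" by blast
            then show ?thesis by (rule R_E) blast
          qed
          then obtain g where g: "\<And>y. y \<in> Y \<Longrightarrow> U n y = f (g y) (U n x)" by metis
          define as where "as = map g ys"
          have as: "f (as ! i) (U n x) = U n (ys ! i)" "ys ! i \<in> Y" if "i < Suc k" for i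
            using that len g[of "ys ! i"] ys(1) by (auto simp: as_def)
          have xB: "U n x \<in> small_index S A k" using x by (simp add: C_def B_def)
          \<comment> \<open>The points of \<open>Y\<close> lie in \<open>C n\<close>, so their
            images lie in \<open>B\<close>, which is contained in \<open>A\<close>; hence the listed
            points qualify for the defining condition of \<open>small_index\<close> at
            \<open>U n x\<close>.\<close>
          have "f (as ! i) (U n x) \<in> A" if "i < Suc k" for i
          proof -
            have "U n (ys ! i) \<in> B" using as(2)[OF that] Y(1) by (auto simp: C_def)
            then show ?thesis using as(1)[OF that] by (simp add: B_def small_index_def)
          qed
          moreover have "length as = Suc k" using len by (simp add: as_def)
          ultimately obtain i j where ij: "i < Suc k" "j < Suc k" "i \<noteq> j"
            "(f (as ! i) (U n x), f (as ! j) (U n x)) \<in> S"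
            using xB unfolding small_index_def by blast
          then have "(U n (ys ! i), U n (ys ! j)) \<in> S" using as(1) by simp
          then have "ys ! i = ys ! j" using n as(2)[OF ij(1)] as(2)[OF ij(2)] Y(1) by blast
          then show False using ij ys(2) len by (simp add: nth_eq_iff_index_eq)
        qed
      qed
    qed
  qed
qed

end

theorem theorem2:
  fixes \<mu> :: "'a::polish_space measure" and R\<^sub>0 S :: "'a rel" and m :: "('a \<times> 'a) measure"
  assumes "standard_prob_space \<mu>"
    and "pmp_rel \<mu> R\<^sub>0" and "ergodic_rel \<mu> R\<^sub>0" and "hyperfinite_rel \<mu> R\<^sub>0"
    and "finite_equiv_measure m (rel_measure \<mu> R\<^sub>0)"
    and "subrel \<mu> R\<^sub>0 S"
  shows "(aperiodic_rel \<mu> S \<and> everywhere_infinite_index \<mu> S R\<^sub>0 \<longleftrightarrow>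
      Sub_topology \<mu> R\<^sub>0 m closure_of rel_orbit \<mu> R\<^sub>0 (full_group \<mu> R\<^sub>0) S = Sub \<mu> R\<^sub>0) \<and>
    (Sub_topology \<mu> R\<^sub>0 m closure_of rel_orbit \<mu> R\<^sub>0 (full_group \<mu> R\<^sub>0) S = Sub \<mu> R\<^sub>0 \<longleftrightarrow>
      Sub_topology \<mu> R\<^sub>0 m closure_of rel_orbit \<mu> R\<^sub>0 (Aut_rel \<mu> R\<^sub>0) S = Sub \<mu> R\<^sub>0)"
    (is "(?i \<longleftrightarrow> ?ii) \<and> (?ii \<longleftrightarrow> ?iii)")
proof -
  obtain f where "pmp_action \<mu> R\<^sub>0 f" using ex_pmp_action[OF assms(1,2)] by blast
  then interpret pmp_action \<mu> R\<^sub>0 f .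
  note iff = closure_eq_Sub_iff[OF assms(5,6)]
  have "full_group \<mu> R\<^sub>0 \<subseteq> meas_aut \<mu>" using full_group_subset by blast
  note full = iff[OF this] and aut = iff[OF full_group_subset(2)]
  have "?ii" if "?i"
    unfolding full using full_group_orbit_dense[OF assms(3,4,5,6)] that by blast
  \<comment> \<open>Approximating elements of the full group are in particular automorphisms of the
    relation.\<close>
  moreover have "?iii" if "?ii"
    using that full_group_subset(1) unfolding full aut by (meson subsetD)
  moreover have "?i" if "?iii"
  proof
    have dense: "\<exists>T\<in>Aut_rel \<mu> R\<^sub>0. measure m (sym_diff S' (map_prod T T ` S \<inter> R\<^sub>0)) < r"
      if "subrel \<mu> R\<^sub>0 S'" "r > 0" for S' r
      using \<open>?iii\<close> that unfolding aut by blast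
    show "aperiodic_rel \<mu> S"
      by (rule dense_imp_aperiodic[OF assms(3,5,6) full_group_subset(2) dense])
    show "everywhere_infinite_index \<mu> S R\<^sub>0"
      by (rule dense_imp_infinite_index[OF assms(3,4,5,6) order_refl dense])
  qed
  ultimately show ?thesis by blast
qed

end
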